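(* The Banach space $W^{1,1}(\mathbb{R}^2)$, equipped with its usual Sobolev norm $\|f\|_{W^{1,1}(\mathbb{R}^2)} = \|f\|_{L^1(\mathbb{R}^2)} + \|\nabla f\|_{L^1(\mathbb{R}^2;\mathbb{R}^2)}$, does not have the slice diameter two property.
   Context: Functions are real-valued, and functions that agree almost everywhere are identified. $W^{1,1}(\mathbb{R}^2)$ is the real vector space of all $f \in L^1(\mathbb{R}^2)$ for which there exists a vector field $\nabla f \in L^1(\mathbb{R}^2;\mathbb{R}^2)$ (the weak gradient) satisfying $$\int_{\mathbb{R}^2} f \, \operatorname{div} \varphi \, dx = - \int_{\mathbb{R}^2} \nabla f \cdot \varphi \, dx$$ for every test function $\varphi \in C_c^1(\mathbb{R}^2;\mathbb{R}^2)$. Here $\|\nabla f\|_{L^1(\mathbb{R}^2;\mathbb{R}^2)} = \int_{\mathbb{R}^2} |\nabla f(x)|\,dx$, with $|\cdot|$ the Euclidean norm on $\mathbb{R}^2$. For a normed space $X$, let $B_X$ be its closed unit ball and $S_{X^*}$ the unit sphere of the dual $X^*$. A slice of $B_X$ is a set of the form $$\operatorname{Slice}(B_X,x^*,\varepsilon) := \{ x \in B_X \mid x^*(x) > 1 - \varepsilon\}, \qquad x^* \in S_{X^*},\ \varepsilon > 0.$$ $X$ has the slice diameter two property if every slice of $B_X$ has diameter $2$ (with respect to the norm of $X$). *)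

theory Defs
  imports "HOL-Analysis.Analysis"
begin

section \<open>Weak gradients\<close>

text \<open>\<open>C\<^sub>c\<^sup>1\<close> vector fields; continuity of the Jacobian matrix is continuity of all
  first partial derivatives.\<close>

definition test_field :: "(real^2 \<Rightarrow> real^2) \<Rightarrow> bool" where
  "test_field \<phi> \<longleftrightarrow>
     (\<forall>x. \<phi> differentiable at x) \<and>
     continuous_on UNIV (\<lambda>x. jacobian \<phi> (at x)) \<and>
     compact (closure {x. \<phi> x \<noteq> 0})"

definition divergence :: "(real^2 \<Rightarrow> real^2) \<Rightarrow> real^2 \<Rightarrow> real" where
  "divergence \<phi> x = trace (jacobian \<phi> (at x))"

definition is_weak_gradient :: "(real^2 \<Rightarrow> real) \<Rightarrow> (real^2 \<Rightarrow> real^2) \<Rightarrow> bool" where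
  "is_weak_gradient f g \<longleftrightarrow>
     integrable lebesgue g \<and>
     (\<forall>\<phi>. test_field \<phi> \<longrightarrow>
        (LINT x|lebesgue. f x * divergence \<phi> x) = - (LINT x|lebesgue. g x \<bullet> \<phi> x))"

text \<open>The choice is determined only up to a null set (\<open>weak_gradient_unique\<close>), so
  \<open>sobolev_norm\<close> does not depend on it (\<open>sobolev_norm_eq\<close>).\<close>

definition weak_gradient :: "(real^2 \<Rightarrow> real) \<Rightarrow> real^2 \<Rightarrow> real^2" where
  "weak_gradient f = (SOME g. is_weak_gradient f g)"

definition sobolev_fun :: "(real^2 \<Rightarrow> real) \<Rightarrow> bool" where
  "sobolev_fun f \<longleftrightarrow> integrable lebesgue f \<and> (\<exists>g. is_weak_gradient f g)"

definition sobolev_norm :: "(real^2 \<Rightarrow> real) \<Rightarrow> real" where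
  "sobolev_norm f = (LINT x|lebesgue. \<bar>f x\<bar>) + (LINT x|lebesgue. norm (weak_gradient f x))"


section \<open>Uniqueness of the weak gradient\<close>

lemma test_field_continuous:
  assumes "test_field \<phi>"
  shows "continuous_on UNIV \<phi>"
  using assms unfolding test_field_def
  by (meson continuous_at_imp_continuous_on differentiable_imp_continuous_within)

lemma divergence_continuous:
  assumes "test_field \<phi>"
  shows "continuous_on UNIV (divergence \<phi>)"
proof -
  have "continuous_on UNIV (\<lambda>x. \<Sum>i\<in>UNIV. jacobian \<phi> (at x) $ i $ i)"
    using assms unfolding test_field_def by (intro continuous_intros) auto
  then show ?thesis
    by (simp add: divergence_def[abs_def] trace_def)
qed

lemma divergence_outside:
  assumes "x \<notin> closure {x. \<phi> x \<noteq> 0}"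
  shows "divergence \<phi> x = 0"
proof -
  have "((\<lambda>y. 0) has_derivative (\<lambda>h. 0)) (at x)" by simp
  then have "(\<phi> has_derivative (\<lambda>h. 0)) (at x)"
  proof (rule has_derivative_transform_within_open)
    show "open (- closure {x. \<phi> x \<noteq> 0})" by auto
    show "0 = \<phi> y" if "y \<in> - closure {x. \<phi> x \<noteq> 0}" for y
      using that closure_subset[of "{x. \<phi> x \<noteq> 0}"] by auto
  qed (use assms in auto)
  then have "frechet_derivative \<phi> (at x) = (\<lambda>h. 0)"
    using frechet_derivative_at by metis
  then show ?thesis
    by (simp add: divergence_def jacobian_def trace_def matrix_def)
qed

lemma bounded_of_compact_support:
  fixes f :: "'a::metric_space \<Rightarrow> 'b::real_normed_vector"
  assumes "continuous_on UNIV f" "compact K" "\<And>x. x \<notin> K \<Longrightarrow> f x = 0"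
  obtains C where "\<And>x. norm (f x) \<le> C"
proof -
  have "compact (f ` K)"
    using assms by (meson compact_continuous_image continuous_on_subset subset_UNIV)
  then obtain C where C: "\<And>y. y \<in> f ` K \<Longrightarrow> norm y \<le> C"
    by (meson bounded_iff compact_imp_bounded)
  have "norm (f x) \<le> max 0 C" for x
  proof (cases "x \<in> K")
    case True
    then have "norm (f x) \<le> C" using C by blast
    then show ?thesis by simp
  qed (simp add: assms(3))
  then show ?thesis using that by blast
qed

lemma test_field_bounded:
  assumes "test_field \<phi>"
  obtains C where "\<And>x. norm (\<phi> x) \<le> C"
proof (rule bounded_of_compact_support[OF test_field_continuous[OF assms]])
  show "compact (closure {x. \<phi> x \<noteq> 0})" using assms by (simp add: test_field_def)
  show "\<phi> x = 0" if "x \<notin> closure {x. \<phi> x \<noteq> 0}" for x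
    using that closure_subset[of "{x. \<phi> x \<noteq> 0}"] by auto
qed auto

lemma divergence_bounded:
  assumes "test_field \<phi>"
  obtains C where "\<And>x. norm (divergence \<phi> x) \<le> C"
proof (rule bounded_of_compact_support[OF divergence_continuous[OF assms]])
  show "compact (closure {x. \<phi> x \<noteq> 0})" using assms by (simp add: test_field_def)
qed (use divergence_outside in auto)

lemma continuous_lebesgue_measurable:
  fixes f :: "'a::euclidean_space \<Rightarrow> 'b::topological_space"
  assumes "continuous_on UNIV f"
  shows "f \<in> borel_measurable lebesgue"
  using assms by (simp add: borel_measurable_continuous_onI measurable_completion)

lemma integrable_mult_divergence:
  assumes "integrable lebesgue f" "test_field \<phi>"
  shows "integrable lebesgue (\<lambda>x. f x * divergence \<phi> x)"
proof -
  obtain C where C: "\<And>x. norm (divergence \<phi> x) \<le> C"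
    using divergence_bounded[OF assms(2)] by blast
  have [measurable]: "divergence \<phi> \<in> borel_measurable lebesgue"
    using divergence_continuous[OF assms(2)] by (rule continuous_lebesgue_measurable)
  have [measurable]: "f \<in> borel_measurable lebesgue" using assms by auto
  show ?thesis
  proof (rule Bochner_Integration.integrable_bound)
    show "integrable lebesgue (\<lambda>x. C * f x)" using assms by auto
    show "AE x in lebesgue. norm (f x * divergence \<phi> x) \<le> norm (C * f x)"
    proof (rule AE_I2)
      fix x
      have "\<bar>divergence \<phi> x\<bar> \<le> \<bar>C\<bar>" using C[of x] by auto
      then show "norm (f x * divergence \<phi> x) \<le> norm (C * f x)"
        using mult_right_mono[of "\<bar>divergence \<phi> x\<bar>" "\<bar>C\<bar>" "\<bar>f x\<bar>"]
        by (simp add: abs_mult mult.commute)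
    qed
  qed measurable
qed

lemma integrable_inner_test_field:
  assumes "integrable lebesgue g" "test_field \<phi>"
  shows "integrable lebesgue (\<lambda>x. g x \<bullet> \<phi> x)"
proof -
  obtain C where C: "\<And>x. norm (\<phi> x) \<le> C"
    using test_field_bounded[OF assms(2)] by blast
  have [measurable]: "\<phi> \<in> borel_measurable lebesgue"
    using test_field_continuous[OF assms(2)] by (rule continuous_lebesgue_measurable)
  have [measurable]: "g \<in> borel_measurable lebesgue" using assms by auto
  show ?thesis
  proof (rule Bochner_Integration.integrable_bound)
    show "integrable lebesgue (\<lambda>x. C * norm (g x))" using assms by auto
    show "AE x in lebesgue. norm (g x \<bullet> \<phi> x) \<le> norm (C * norm (g x))"
    proof (rule AE_I2)
      fix x
      have "norm (g x \<bullet> \<phi> x) \<le> norm (g x) * norm (\<phi> x)"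
        by (simp add: Cauchy_Schwarz_ineq2)
      also have "\<dots> \<le> norm (g x) * \<bar>C\<bar>"
        using C[of x] by (intro mult_left_mono) auto
      finally show "norm (g x \<bullet> \<phi> x) \<le> norm (C * norm (g x))"
        by (simp add: abs_mult mult.commute)
    qed
  qed measurable
qed

definition C1_fun :: "(real^2 \<Rightarrow> real) \<Rightarrow> bool" where
  "C1_fun \<psi> \<longleftrightarrow> (\<exists>d. continuous_on UNIV d \<and> (\<forall>x. (\<psi> has_derivative (\<lambda>h. d x \<bullet> h)) (at x)))"

lemma C1_fun_continuous: "C1_fun \<psi> \<Longrightarrow> continuous_on UNIV \<psi>"
  unfolding C1_fun_def
  by (meson continuous_at_imp_continuous_on has_derivative_continuous)

lemma C1_fun_const: "C1_fun (\<lambda>x. c)"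
  unfolding C1_fun_def by (intro exI[of _ "\<lambda>x. 0"]) (simp add: inner_zero_left[abs_def])

lemma C1_fun_mult:
  assumes "C1_fun f" "C1_fun g"
  shows "C1_fun (\<lambda>x. f x * g x)"
proof -
  obtain d where d: "continuous_on UNIV d" "\<And>x. (f has_derivative (\<lambda>h. d x \<bullet> h)) (at x)"
    using assms unfolding C1_fun_def by blast
  obtain e where e: "continuous_on UNIV e" "\<And>x. (g has_derivative (\<lambda>h. e x \<bullet> h)) (at x)"
    using assms unfolding C1_fun_def by blast
  have "((\<lambda>x. f x * g x) has_derivative (\<lambda>h. (f x *\<^sub>R e x + g x *\<^sub>R d x) \<bullet> h)) (at x)" for x
    by (rule has_derivative_eq_rhs[OF has_derivative_mult[OF d(2) e(2)]])
       (auto simp: inner_add_left)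
  moreover have "continuous_on UNIV (\<lambda>x. f x *\<^sub>R e x + g x *\<^sub>R d x)"
    by (intro continuous_intros d e C1_fun_continuous assms)
  ultimately show ?thesis unfolding C1_fun_def by (intro exI conjI allI)
qed

lemma C1_fun_comp:
  assumes "C1_fun f" "continuous_on (range f) g'"
    and "\<And>x. (g has_real_derivative g' (f x)) (at (f x))"
  shows "C1_fun (\<lambda>x. g (f x))"
proof -
  obtain d where d: "continuous_on UNIV d" "\<And>x. (f has_derivative (\<lambda>h. d x \<bullet> h)) (at x)"
    using assms unfolding C1_fun_def by blast
  have "((\<lambda>x. g (f x)) has_derivative (\<lambda>h. (g' (f x) *\<^sub>R d x) \<bullet> h)) (at x)" for x
    using has_derivative_compose[OF d(2)[of x] assms(3)[of x, unfolded has_field_derivative_def]]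
    by simp
  moreover have "continuous_on UNIV (\<lambda>x. g' (f x) *\<^sub>R d x)"
    by (intro continuous_intros d continuous_on_compose2[OF assms(2) C1_fun_continuous[OF assms(1)]]) auto
  ultimately show ?thesis unfolding C1_fun_def by (intro exI conjI allI)
qed

lemma has_real_derivative_pos_part_sq:
  "((\<lambda>t::real. (max 0 t)\<^sup>2) has_real_derivative 2 * max 0 t) (at t)"
proof -
  consider "t < 0" | "t > 0" | "t = 0" by linarith
  then show ?thesis
  proof cases
    case 1
    have "((\<lambda>t::real. 0) has_real_derivative 2 * max 0 t) (at t)" using 1 by simp
    then show ?thesis
      by (rule has_field_derivative_transform_within_open[where S="{..<0}"]) (use 1 in auto)
  next
    case 2
    have "((\<lambda>t::real. t\<^sup>2) has_real_derivative 2 * max 0 t) (at t)"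
      using 2 by (auto intro!: derivative_eq_intros)
    then show ?thesis
      by (rule has_field_derivative_transform_within_open[where S="{0<..}"]) (use 2 in auto)
  next
    case 3
    have "((\<lambda>h::real. max 0 h) \<longlongrightarrow> 0) (at 0)"
      by (auto intro!: tendsto_eq_intros)
    moreover have "max 0 h = ((max 0 (0 + h))\<^sup>2 - (max 0 0)\<^sup>2) / h" if "h \<noteq> 0" for h :: real
      using that by (auto simp: max_def power2_eq_square)
    ultimately have "((\<lambda>h::real. ((max 0 (0 + h))\<^sup>2 - (max 0 0)\<^sup>2) / h) \<longlongrightarrow> 0) (at 0)"
      by (smt (verit, ccfv_SIG) Lim_cong_within UNIV_I)
    then show ?thesis unfolding 3 DERIV_def by simp
  qed
qed

lemma C1_fun_coord: "C1_fun (\<lambda>x. x $ i)"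
  unfolding C1_fun_def
proof (intro exI[of _ "\<lambda>x. axis i 1"] conjI allI)
  show "((\<lambda>x. x $ i) has_derivative (\<lambda>h. axis i 1 \<bullet> h)) (at x)" for x :: "real^2"
    unfolding inner_axis' by (simp add: bounded_linear_imp_has_derivative bounded_linear_vec_nth)
qed auto

lemma C1_fun_affine: "C1_fun (\<lambda>x. c * x $ i + e)"
proof (rule C1_fun_comp[OF C1_fun_coord, where g' = "\<lambda>_. c" and g = "\<lambda>t. c * t + e"])
  show "((\<lambda>t. c * t + e) has_real_derivative c) (at (x $ i))" for x :: "real^2"
    by (auto intro!: derivative_eq_intros)
qed auto

lemma C1_fun_pos_part_sq:
  assumes "C1_fun f"
  shows "C1_fun (\<lambda>x. (max 0 (f x))\<^sup>2)"
  using assms _ has_real_derivative_pos_part_sq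
  by (rule C1_fun_comp) (auto intro!: continuous_intros)

lemma C1_fun_prod: "finite I \<Longrightarrow> (\<And>i. i \<in> I \<Longrightarrow> C1_fun (f i)) \<Longrightarrow> C1_fun (\<lambda>x. \<Prod>i\<in>I. f i x)"
  by (induction I rule: finite_induct) (auto intro: C1_fun_const C1_fun_mult)

lemma test_field_of_C1_fun:
  assumes "C1_fun \<psi>" "bounded {x. \<psi> x \<noteq> 0}"
  shows "test_field (\<lambda>x. \<psi> x *\<^sub>R v)"
proof -
  obtain d where d: "continuous_on UNIV d" "\<And>x. (\<psi> has_derivative (\<lambda>h. d x \<bullet> h)) (at x)"
    using assms unfolding C1_fun_def by blast
  have D: "((\<lambda>x. \<psi> x *\<^sub>R v) has_derivative (\<lambda>h. (d x \<bullet> h) *\<^sub>R v)) (at x)" for x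
    using d(2)[of x] by (rule has_derivative_scaleR_left)
  then have F: "frechet_derivative (\<lambda>x. \<psi> x *\<^sub>R v) (at x) = (\<lambda>h. (d x \<bullet> h) *\<^sub>R v)" for x
    by (metis frechet_derivative_at)
  have "continuous_on UNIV (\<lambda>x. jacobian (\<lambda>x. \<psi> x *\<^sub>R v) (at x))"
    unfolding jacobian_def F matrix_def
    by (intro continuous_intros d)
  moreover have "compact (closure {x. \<psi> x *\<^sub>R v \<noteq> 0})"
    using assms(2) by (auto intro: bounded_subset)
  ultimately show ?thesis
    using D unfolding test_field_def differentiable_def by blast
qed

lemma integral_box_zero:
  fixes g :: "real^2 \<Rightarrow> real"
  assumes g: "integrable lebesgue g"
    and zero: "\<And>\<psi>. C1_fun \<psi> \<Longrightarrow> bounded {x. \<psi> x \<noteq> 0} \<Longrightarrow> (LINT x|lebesgue. g x * \<psi> x) = 0"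
  shows "(LINT x:box a b|lebesgue. g x) = 0"
proof -
  define u :: "real^2 \<Rightarrow> real" where
    "u = (\<lambda>x. \<Prod>i\<in>UNIV. (max 0 (1 * x $ i + (- a $ i)))\<^sup>2 * (max 0 (-1 * x $ i + b $ i))\<^sup>2)"
  have u_C1: "C1_fun u"
    unfolding u_def by (intro C1_fun_prod C1_fun_mult C1_fun_pos_part_sq C1_fun_affine) auto
  have u_nonneg: "u x \<ge> 0" for x unfolding u_def by (intro prod_nonneg) auto
  have u_zero: "u x = 0 \<longleftrightarrow> x \<notin> box a b" for x
  proof -
    have "u x = 0 \<longleftrightarrow> (\<exists>i. max 0 (x $ i - a $ i) = 0 \<or> max 0 (b $ i - x $ i) = 0)"
      unfolding u_def by simp
    also have "\<dots> \<longleftrightarrow> (\<exists>i. \<not> (a $ i < x $ i \<and> x $ i < b $ i))"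
      by (intro ex_cong1) (auto simp: max_def)
    also have "\<dots> \<longleftrightarrow> x \<notin> box a b" by (simp add: mem_box_cart)
    finally show ?thesis .
  qed
  define \<psi> where "\<psi> n x = real n * u x / (1 + real n * u x)" for n x
  have \<psi>_C1: "C1_fun (\<psi> n)" for n
    unfolding \<psi>_def
  proof (rule C1_fun_comp[OF u_C1, where g = "\<lambda>t. real n * t / (1 + real n * t)"
          and g' = "\<lambda>t. real n / (1 + real n * t)\<^sup>2"])
    have pos: "1 + real n * u x > 0" for x using u_nonneg[of x]
      by (simp add: add_pos_nonneg)
    then show "continuous_on (range u) (\<lambda>t. real n / (1 + real n * t)\<^sup>2)"
      by (intro continuous_intros) (auto simp: less_le)
    show "((\<lambda>t. real n * t / (1 + real n * t)) has_real_derivative real n / (1 + real n * u x)\<^sup>2) (at (u x))" for x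
      using pos[of x] by (auto intro!: derivative_eq_intros simp: field_simps power2_eq_square)
  qed
  have \<psi>_bnd: "bounded {x. \<psi> n x \<noteq> 0}" for n
    by (rule bounded_subset[OF bounded_box[of a b]]) (auto simp: \<psi>_def u_zero)
  have \<psi>_01: "\<bar>\<psi> n x\<bar> \<le> 1" for n x
    using u_nonneg[of x] by (auto simp: \<psi>_def field_simps add_nonneg_pos add_pos_nonneg)
  have [measurable]: "\<psi> n \<in> borel_measurable lebesgue" for n
    using C1_fun_continuous[OF \<psi>_C1] by (rule continuous_lebesgue_measurable)
  have [measurable]: "g \<in> borel_measurable lebesgue" using g by auto
  have lim: "(\<lambda>n. \<psi> n x) \<longlonglongrightarrow> indicator (box a b) x" for x
  proof (cases "x \<in> box a b")
    case False
    then show ?thesis by (simp add: \<psi>_def u_zero[THEN iffD2])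
  next
    case True
    then have "u x > 0" using u_nonneg[of x] u_zero[of x] by auto
    then have "(\<lambda>n. real n * u x / (1 + real n * u x)) \<longlonglongrightarrow> 1" by real_asymp
    then show ?thesis using True by (simp add: \<psi>_def)
  qed
  have "(\<lambda>n. LINT x|lebesgue. g x * \<psi> n x) \<longlonglongrightarrow> (LINT x|lebesgue. g x * indicator (box a b) x)"
  proof (rule integral_dominated_convergence[where w = "\<lambda>x. norm (g x)"])
    show "integrable lebesgue (\<lambda>x. norm (g x))" using g by auto
    show "AE x in lebesgue. (\<lambda>n. g x * \<psi> n x) \<longlonglongrightarrow> g x * indicator (box a b) x"
      using lim by (intro AE_I2 tendsto_mult) auto
    show "AE x in lebesgue. norm (g x * \<psi> n x) \<le> norm (g x)" for n
      using \<psi>_01 by (intro AE_I2) (auto simp: abs_mult intro: mult_right_le_one_le)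
    show "(\<lambda>x. g x * indicator (box a b) x) \<in> borel_measurable lebesgue"
      by (intro borel_measurable_times borel_measurable_indicator) auto
  qed measurable
  moreover have "(LINT x|lebesgue. g x * \<psi> n x) = 0" for n
    using zero \<psi>_C1 \<psi>_bnd by blast
  ultimately have "(LINT x|lebesgue. g x * indicator (box a b) x) = 0"
    by (simp add: LIMSEQ_const_iff)
  then show ?thesis by (simp add: set_lebesgue_integral_def mult.commute)
qed

lemma sigma_finite_lebesgue: "sigma_finite_measure (lebesgue :: 'a::euclidean_space measure)"
proof
  obtain A :: "'a set set" where A: "countable A" "A \<subseteq> sets lborel" "\<Union>A = space lborel"
    "\<forall>a\<in>A. emeasure lborel a \<noteq> \<infinity>"
    using lborel.sigma_finite_countable by blast
  then show "\<exists>A::'a set set. countable A \<and> A \<subseteq> sets lebesgue \<and> \<Union>A = space lebesgue \<and>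
      (\<forall>a\<in>A. emeasure lebesgue a \<noteq> \<infinity>)"
    by (intro exI[of _ A]) (auto simp: subset_iff)
qed

lemma AE_zero_of_integral_box:
  fixes g :: "real^2 \<Rightarrow> real"
  assumes g: "integrable lebesgue g"
    and box: "\<And>a b. (LINT x:box a b|lebesgue. g x) = 0"
  shows "AE x in lebesgue. g x = 0"
proof (rule sigma_finite_measure.density_zero[OF sigma_finite_lebesgue g])
  have gm [measurable]: "g \<in> borel_measurable lebesgue" using g by auto
  have si: "set_integrable lebesgue A g" if "A \<in> sets lebesgue" for A
    using integrable_mult_indicator[OF that g] by (simp add: set_integrable_def)
  have total: "(LINT x|lebesgue. g x) = 0"
  proof -
    define B :: "nat \<Rightarrow> (real^2) set" where "B n = box (- (\<chi> i. real n)) (\<chi> i. real n)" for n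
    have "(\<lambda>n. LINT x|lebesgue. indicator (B n) x * g x) \<longlonglongrightarrow> (LINT x|lebesgue. g x)"
    proof (rule integral_dominated_convergence[where w = "\<lambda>x. norm (g x)"])
      show "integrable lebesgue (\<lambda>x. norm (g x))" using g by auto
      show "AE x in lebesgue. (\<lambda>n. indicator (B n) x * g x) \<longlonglongrightarrow> g x"
      proof (rule AE_I2)
        fix x :: "real^2"
        obtain N where N: "norm x < real N" using reals_Archimedean2 by blast
        have "indicator (B n) x * g x = g x" if "n \<ge> N" for n
        proof -
          have "\<bar>x $ i\<bar> < real n" for i using component_le_norm_cart[of x i] N that by simp
          then have "x \<in> B n" by (auto simp: B_def mem_box_cart abs_less_iff) (smt (verit))
          then show ?thesis by simp
        qed
        then show "(\<lambda>n. indicator (B n) x * g x) \<longlonglongrightarrow> g x"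
          by (intro tendsto_eventually) (auto simp: eventually_sequentially)
      qed
      show "AE x in lebesgue. norm (indicator (B n) x * g x) \<le> norm (g x)" for n
        by (intro AE_I2) (auto simp: indicator_def)
      show "(\<lambda>x. indicator (B n) x * g x) \<in> borel_measurable lebesgue" for n
        unfolding B_def using gm by (intro borel_measurable_times borel_measurable_indicator) auto
    qed auto
    moreover have "(LINT x|lebesgue. indicator (B n) x * g x) = 0" for n
      using box unfolding B_def set_lebesgue_integral_def by simp
    ultimately show ?thesis by (simp add: LIMSEQ_const_iff)
  qed
  let ?G = "range (\<lambda>(a, b). box a b :: (real^2) set)"
  have eq: "sets borel = sigma_sets UNIV ?G"
    by (subst borel_eq_box) simp
  have borel: "(LINT x:A|lebesgue. g x) = 0" if "A \<in> sets borel" for A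
  proof -
    have "Int_stable ?G" by (auto simp: Int_stable_def box_Int_box)
    moreover have "?G \<subseteq> Pow UNIV" by auto
    moreover have "A \<in> sigma_sets UNIV ?G" using that eq by simp
    ultimately show ?thesis
    proof (induction rule: sigma_sets_induct_disjoint)
      case (basic A)
      then show ?case using box by auto
    next
      case empty
      then show ?case by (simp add: set_lebesgue_integral_def)
    next
      case (compl A)
      then have A: "A \<in> sets lebesgue" using eq by auto
      have "(LINT x:UNIV|lebesgue. g x) = (LINT x:A \<union> (UNIV - A)|lebesgue. g x)" by simp
      also have "\<dots> = (LINT x:A|lebesgue. g x) + (LINT x:UNIV - A|lebesgue. g x)"
        using A by (intro set_integral_Un si) auto
      finally show ?case using compl total by (simp add: set_lebesgue_integral_def)
    next
      case (union A)
      have "A i \<in> sets borel" for i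
        unfolding eq using union(2) by (meson rangeI subsetD)
      then have A: "A i \<in> sets lebesgue" for i by simp
      have "(LINT x:(\<Union>i. A i)|lebesgue. g x) = (\<Sum>i. (LINT x:(A i)|lebesgue. g x))"
        using A union(1)
        by (intro lebesgue_integral_countable_add si) (auto simp: disjoint_family_on_def)
      then show ?case using union by simp
    qed
  qed
  show "(LINT x:A|lebesgue. g x) = 0" if A: "A \<in> sets lebesgue" for A
  proof -
    obtain S N N' where S: "A = S \<union> N" "N \<subseteq> N'" "N' \<in> null_sets lborel" "S \<in> sets lborel"
      using A by (rule sets_completionE)
    have "N' \<in> null_sets lebesgue" using S(3) by (rule null_sets_completionI)
    then have "AE x in lebesgue. x \<notin> N'" by (rule AE_not_in)
    then have "AE x in lebesgue. indicator A x *\<^sub>R g x = indicator S x *\<^sub>R g x"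
      by eventually_elim (use S in \<open>auto simp: indicator_def\<close>)
    moreover have "(\<lambda>x. indicator A x *\<^sub>R g x) \<in> borel_measurable lebesgue"
      using si[OF A] unfolding set_integrable_def by auto
    moreover have "(\<lambda>x. indicator S x *\<^sub>R g x) \<in> borel_measurable lebesgue"
      using si[of S] S(4) unfolding set_integrable_def by auto
    ultimately have "(LINT x:A|lebesgue. g x) = (LINT x:S|lebesgue. g x)"
      unfolding set_lebesgue_integral_def by (intro integral_cong_AE)
    then show ?thesis using borel S(4) by simp
  qed
qed

lemma weak_gradient_unique:
  assumes g: "is_weak_gradient f g" and h: "is_weak_gradient f h"
  shows "AE x in lebesgue. g x = h x"
proof -
  have gi: "integrable lebesgue g" "integrable lebesgue h"
    using assms by (auto simp: is_weak_gradient_def)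
  have "AE x in lebesgue. g x $ i - h x $ i = 0" for i
  proof (rule AE_zero_of_integral_box)
    have int: "integrable lebesgue (\<lambda>x. g x $ i - h x $ i)"
      using gi by (intro Bochner_Integration.integrable_diff
          integrable_bounded_linear[OF bounded_linear_vec_nth])
    then show "integrable lebesgue (\<lambda>x. g x $ i - h x $ i)" .
    show "(LINT x:box a b|lebesgue. g x $ i - h x $ i) = 0" for a b
    proof (rule integral_box_zero[OF int])
      fix \<psi> assume \<psi>: "C1_fun \<psi>" "bounded {x. \<psi> x \<noteq> 0}"
      let ?\<phi> = "\<lambda>x. \<psi> x *\<^sub>R axis i 1 :: real^2"
      have t: "test_field ?\<phi>" using \<psi> by (rule test_field_of_C1_fun)
      have "(LINT x|lebesgue. g x \<bullet> ?\<phi> x) = (LINT x|lebesgue. h x \<bullet> ?\<phi> x)"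
      proof -
        have "(LINT x|lebesgue. f x * divergence ?\<phi> x) = - (LINT x|lebesgue. g x \<bullet> ?\<phi> x)"
          using g t unfolding is_weak_gradient_def by blast
        moreover have "(LINT x|lebesgue. f x * divergence ?\<phi> x) = - (LINT x|lebesgue. h x \<bullet> ?\<phi> x)"
          using h t unfolding is_weak_gradient_def by blast
        ultimately show ?thesis by simp
      qed
      then have "(LINT x|lebesgue. g x \<bullet> ?\<phi> x - h x \<bullet> ?\<phi> x) = 0"
        using integrable_inner_test_field[OF gi(1) t] integrable_inner_test_field[OF gi(2) t]
        by simp
      moreover have "g x \<bullet> ?\<phi> x - h x \<bullet> ?\<phi> x = (g x $ i - h x $ i) * \<psi> x" for x
        by (simp add: inner_axis algebra_simps)
      ultimately show "(LINT x|lebesgue. (g x $ i - h x $ i) * \<psi> x) = 0" by simp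
    qed
  qed
  then have "AE x in lebesgue. \<forall>i\<in>UNIV. g x $ i - h x $ i = 0"
    by (subst AE_finite_all) auto
  then show ?thesis by eventually_elim (simp add: vec_eq_iff)
qed



section \<open>The space \<open>W\<^sup>1\<^sup>,\<^sup>1\<close>\<close>

lemma is_weak_gradient_integrable: "is_weak_gradient f g \<Longrightarrow> integrable lebesgue g"
  by (simp add: is_weak_gradient_def)

lemma is_weak_gradient_eq:
  "is_weak_gradient f g \<Longrightarrow> test_field \<phi> \<Longrightarrow>
     (LINT x|lebesgue. f x * divergence \<phi> x) = - (LINT x|lebesgue. g x \<bullet> \<phi> x)"
  by (simp add: is_weak_gradient_def)

lemma is_weak_gradient_add:
  assumes "integrable lebesgue f" "is_weak_gradient f g"
    and "integrable lebesgue f'" "is_weak_gradient f' g'"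
  shows "is_weak_gradient (\<lambda>x. f x + f' x) (\<lambda>x. g x + g' x)"
  unfolding is_weak_gradient_def
proof (intro conjI allI impI)
  show "integrable lebesgue (\<lambda>x. g x + g' x)"
    using assms by (auto dest: is_weak_gradient_integrable)
  fix \<phi> assume \<phi>: "test_field \<phi>"
  have "(LINT x|lebesgue. (f x + f' x) * divergence \<phi> x)
      = (LINT x|lebesgue. f x * divergence \<phi> x) + (LINT x|lebesgue. f' x * divergence \<phi> x)"
    unfolding distrib_right
    by (intro Bochner_Integration.integral_add integrable_mult_divergence assms \<phi>)
  moreover have "(LINT x|lebesgue. (g x + g' x) \<bullet> \<phi> x)
      = (LINT x|lebesgue. g x \<bullet> \<phi> x) + (LINT x|lebesgue. g' x \<bullet> \<phi> x)"
    unfolding inner_add_left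
    by (intro Bochner_Integration.integral_add integrable_inner_test_field
        is_weak_gradient_integrable[OF assms(2)] is_weak_gradient_integrable[OF assms(4)] \<phi>)
  ultimately show "(LINT x|lebesgue. (f x + f' x) * divergence \<phi> x)
      = - (LINT x|lebesgue. (g x + g' x) \<bullet> \<phi> x)"
    using is_weak_gradient_eq[OF assms(2) \<phi>] is_weak_gradient_eq[OF assms(4) \<phi>] by simp
qed

lemma is_weak_gradient_scale:
  assumes "is_weak_gradient f g"
  shows "is_weak_gradient (\<lambda>x. c * f x) (\<lambda>x. c *\<^sub>R g x)"
  using assms unfolding is_weak_gradient_def by (auto simp: mult.assoc)

lemma is_weak_gradient_zero: "is_weak_gradient (\<lambda>x. 0) (\<lambda>x. 0)"
  unfolding is_weak_gradient_def by simp

lemma is_weak_gradient_cong: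
  assumes "is_weak_gradient f g" "f \<in> borel_measurable lebesgue" "f' \<in> borel_measurable lebesgue"
    and "AE x in lebesgue. f x = f' x"
  shows "is_weak_gradient f' g"
  unfolding is_weak_gradient_def
proof (intro conjI allI impI)
  fix \<phi> assume \<phi>: "test_field \<phi>"
  have [measurable]: "divergence \<phi> \<in> borel_measurable lebesgue"
    using divergence_continuous[OF \<phi>] by (rule continuous_lebesgue_measurable)
  have "(LINT x|lebesgue. f' x * divergence \<phi> x) = (LINT x|lebesgue. f x * divergence \<phi> x)"
    using assms(4) by (intro integral_cong_AE borel_measurable_times assms) (auto elim: eventually_mono)
  then show "(LINT x|lebesgue. f' x * divergence \<phi> x) = - (LINT x|lebesgue. g x \<bullet> \<phi> x)"
    using is_weak_gradient_eq[OF assms(1) \<phi>] by simp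
qed (use assms in \<open>auto dest: is_weak_gradient_integrable\<close>)

lemma sobolev_fun_zero: "sobolev_fun (\<lambda>x. 0)"
  unfolding sobolev_fun_def using is_weak_gradient_zero by auto

lemma sobolev_fun_add: "sobolev_fun f \<Longrightarrow> sobolev_fun g \<Longrightarrow> sobolev_fun (\<lambda>x. f x + g x)"
  unfolding sobolev_fun_def using is_weak_gradient_add by blast

lemma sobolev_fun_scale: "sobolev_fun f \<Longrightarrow> sobolev_fun (\<lambda>x. c * f x)"
  unfolding sobolev_fun_def using is_weak_gradient_scale by auto

lemma weak_gradient: "sobolev_fun f \<Longrightarrow> is_weak_gradient f (weak_gradient f)"
  unfolding sobolev_fun_def weak_gradient_def by (rule someI_ex[of "is_weak_gradient f"]) blast

lemma sobolev_norm_eq: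
  assumes "is_weak_gradient f g"
  shows "sobolev_norm f = (LINT x|lebesgue. \<bar>f x\<bar>) + (LINT x|lebesgue. norm (g x))"
proof -
  have wg: "is_weak_gradient f (weak_gradient f)"
    unfolding weak_gradient_def using assms by (rule someI[of "is_weak_gradient f"])
  have "(LINT x|lebesgue. norm (weak_gradient f x)) = (LINT x|lebesgue. norm (g x))"
  proof (rule integral_cong_AE)
    show "AE x in lebesgue. norm (weak_gradient f x) = norm (g x)"
      using weak_gradient_unique[OF wg assms] by (auto elim: eventually_mono)
  qed (use is_weak_gradient_integrable[OF wg] is_weak_gradient_integrable[OF assms] in auto)
  then show ?thesis by (simp add: sobolev_norm_def)
qed

lemma sobolev_norm_cong:
  assumes "sobolev_fun f" "sobolev_fun g" "AE x in lebesgue. f x = g x"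
  shows "sobolev_norm f = sobolev_norm g"
proof -
  have m: "f \<in> borel_measurable lebesgue" "g \<in> borel_measurable lebesgue"
    using assms by (auto simp: sobolev_fun_def)
  have "(LINT x|lebesgue. \<bar>f x\<bar>) = (LINT x|lebesgue. \<bar>g x\<bar>)"
    using assms(3) m by (intro integral_cong_AE) (auto elim: eventually_mono)
  moreover have "is_weak_gradient g (weak_gradient f)"
    by (rule is_weak_gradient_cong[OF weak_gradient[OF assms(1)] m assms(3)])
  ultimately show ?thesis
    using sobolev_norm_eq weak_gradient[OF assms(1)] by metis
qed

lemma sobolev_norm_nonneg: "0 \<le> sobolev_norm f"
  by (simp add: sobolev_norm_def)

lemma sobolev_norm_triangle:
  assumes "sobolev_fun f" "sobolev_fun g"
  shows "sobolev_norm (\<lambda>x. f x + g x) \<le> sobolev_norm f + sobolev_norm g"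
proof -
  let ?F = "weak_gradient f" and ?G = "weak_gradient g"
  have i: "integrable lebesgue f" "integrable lebesgue g" using assms by (auto simp: sobolev_fun_def)
  have wf: "is_weak_gradient f ?F" and wg: "is_weak_gradient g ?G" using assms by (auto intro: weak_gradient)
  have I: "integrable lebesgue ?F" "integrable lebesgue ?G"
    using wf wg by (auto dest: is_weak_gradient_integrable)
  have "(LINT x|lebesgue. \<bar>f x + g x\<bar>) \<le> (LINT x|lebesgue. \<bar>f x\<bar> + \<bar>g x\<bar>)"
    using i by (intro integral_mono) auto
  moreover have "(LINT x|lebesgue. norm (?F x + ?G x)) \<le> (LINT x|lebesgue. norm (?F x) + norm (?G x))"
    using I by (intro integral_mono) (auto simp: norm_triangle_ineq)
  ultimately show ?thesis
    unfolding sobolev_norm_eq[OF is_weak_gradient_add[OF i(1) wf i(2) wg]]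
      sobolev_norm_eq[OF wf] sobolev_norm_eq[OF wg]
    using i I by simp
qed

lemma sobolev_norm_scale:
  assumes "sobolev_fun f"
  shows "sobolev_norm (\<lambda>x. c * f x) = \<bar>c\<bar> * sobolev_norm f"
  unfolding sobolev_norm_eq[OF is_weak_gradient_scale[OF weak_gradient[OF assms]]]
    sobolev_norm_eq[OF weak_gradient[OF assms]]
  by (simp add: abs_mult distrib_left)

lemma sobolev_norm_eq_0:
  assumes "sobolev_fun f"
  shows "sobolev_norm f = 0 \<longleftrightarrow> (AE x in lebesgue. f x = 0)"
proof
  assume "sobolev_norm f = 0"
  then have "(LINT x|lebesgue. \<bar>f x\<bar>) = 0"
    unfolding sobolev_norm_def by (simp add: add_nonneg_eq_0_iff)
  then show "AE x in lebesgue. f x = 0"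
    using assms by (subst (asm) integral_nonneg_eq_0_iff_AE) (auto simp: sobolev_fun_def)
next
  assume "AE x in lebesgue. f x = 0"
  then have "sobolev_norm f = sobolev_norm (\<lambda>x. 0)"
    using assms sobolev_fun_zero by (intro sobolev_norm_cong) auto
  then show "sobolev_norm f = 0" by (simp add: sobolev_norm_eq[OF is_weak_gradient_zero])
qed

text \<open>The relation is partial: only Sobolev functions are represented, identified when they
  agree almost everywhere.\<close>

definition sobolev_eq :: "(real^2 \<Rightarrow> real) \<Rightarrow> (real^2 \<Rightarrow> real) \<Rightarrow> bool" where
  "sobolev_eq f g \<longleftrightarrow> sobolev_fun f \<and> sobolev_fun g \<and> (AE x in lebesgue. f x = g x)"

lemma part_equivp_sobolev_eq: "part_equivp sobolev_eq"
proof (rule part_equivpI)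
  show "\<exists>f. sobolev_eq f f" using sobolev_fun_zero by (auto simp: sobolev_eq_def)
  show "symp sobolev_eq"
    by (rule sympI) (auto simp: sobolev_eq_def elim: eventually_mono)
  show "transp sobolev_eq"
    by (rule transpI) (auto simp: sobolev_eq_def elim: eventually_elim2)
qed

quotient_type W11 = "real^2 \<Rightarrow> real" / partial: sobolev_eq
  by (rule part_equivp_sobolev_eq)

instantiation W11 :: real_normed_vector
begin

lift_definition zero_W11 :: W11 is "\<lambda>x. 0"
  by (simp add: sobolev_eq_def sobolev_fun_zero)

lift_definition plus_W11 :: "W11 \<Rightarrow> W11 \<Rightarrow> W11" is "\<lambda>f g x. f x + g x"
  by (auto simp: sobolev_eq_def sobolev_fun_add elim: eventually_elim2)

lift_definition scaleR_W11 :: "real \<Rightarrow> W11 \<Rightarrow> W11" is "\<lambda>c f x. c * f x"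
  by (auto simp: sobolev_eq_def sobolev_fun_scale elim: eventually_mono)

lift_definition norm_W11 :: "W11 \<Rightarrow> real" is sobolev_norm
  by (auto simp: sobolev_eq_def intro: sobolev_norm_cong)

definition uminus_W11 :: "W11 \<Rightarrow> W11" where "uminus_W11 f = (-1) *\<^sub>R f"

definition minus_W11 :: "W11 \<Rightarrow> W11 \<Rightarrow> W11" where "minus_W11 f g = f + - g"

definition dist_W11 :: "W11 \<Rightarrow> W11 \<Rightarrow> real" where "dist_W11 f g = norm (f - g)"

definition sgn_W11 :: "W11 \<Rightarrow> W11" where "sgn_W11 f = inverse (norm f) *\<^sub>R f"

definition uniformity_W11 :: "(W11 \<times> W11) filter" where
  "uniformity_W11 = (INF e\<in>{0 <..}. principal {(x, y). dist x y < e})"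

definition open_W11 :: "W11 set \<Rightarrow> bool" where
  "open_W11 U \<longleftrightarrow> (\<forall>x\<in>U. \<forall>\<^sub>F (x', y) in uniformity. x' = x \<longrightarrow> y \<in> U)"

instance
proof
  fix f g h :: W11 and a b :: real and U :: "W11 set"
  show "f + g + h = f + (g + h)"
    by transfer (auto simp: sobolev_eq_def sobolev_fun_add algebra_simps)
  show "f + g = g + f"
    by transfer (auto simp: sobolev_eq_def sobolev_fun_add algebra_simps)
  show "0 + f = f"
    by transfer (auto simp: sobolev_eq_def)
  show "- f + f = 0"
    unfolding uminus_W11_def
    by transfer (simp add: sobolev_eq_def sobolev_fun_zero)
  show "f - g = f + - g" by (rule minus_W11_def)
  show "a *\<^sub>R (f + g) = a *\<^sub>R f + a *\<^sub>R g"
    by transfer (auto simp: sobolev_eq_def sobolev_fun_add sobolev_fun_scale distrib_left)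
  show "(a + b) *\<^sub>R f = a *\<^sub>R f + b *\<^sub>R f"
    by transfer (auto simp: sobolev_eq_def sobolev_fun_add sobolev_fun_scale distrib_right)
  show "a *\<^sub>R b *\<^sub>R f = (a * b) *\<^sub>R f"
    by transfer (auto simp: sobolev_eq_def sobolev_fun_scale mult.assoc
        dest: sobolev_fun_scale[of _ "a * b"])
  show "1 *\<^sub>R f = f"
    by transfer (auto simp: sobolev_eq_def)
  show "norm f = 0 \<longleftrightarrow> f = 0"
    by transfer (auto simp: sobolev_eq_def sobolev_norm_eq_0 sobolev_fun_zero)
  show "norm (f + g) \<le> norm f + norm g"
    by transfer (auto simp: sobolev_eq_def intro: sobolev_norm_triangle)
  show "norm (a *\<^sub>R f) = \<bar>a\<bar> * norm f"
    by transfer (auto simp: sobolev_eq_def intro: sobolev_norm_scale)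
qed (simp_all add: dist_W11_def sgn_W11_def uniformity_W11_def open_W11_def)

end

lemma L1_complete:
  fixes s :: "nat \<Rightarrow> 'a \<Rightarrow> 'b::{banach, second_countable_topology}"
  assumes s: "\<And>n. integrable M (s n)"
    and Cauchy: "\<And>e. e > 0 \<Longrightarrow> \<exists>N. \<forall>i\<ge>N. \<forall>j\<ge>N. (LINT x|M. norm (s i x - s j x)) < e"
  obtains f where "integrable M f" "(\<lambda>n. LINT x|M. norm (s n x - f x)) \<longlonglongrightarrow> 0"
proof -
  obtain r where r: "strict_mono r" "AE x in M. Cauchy (\<lambda>i. s (r i) x)"
    using cauchy_L1_AE_cauchy_subseq[OF s Cauchy] by blast
  have [measurable]: "s n \<in> borel_measurable M" for n using s by auto
  define f where "f x = lim (\<lambda>i. s (r i) x)" for x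
  have fm [measurable]: "f \<in> borel_measurable M" unfolding f_def by measurable
  have conv: "AE x in M. (\<lambda>i. s (r i) x) \<longlonglongrightarrow> f x"
    using r(2) by eventually_elim (auto simp: f_def Cauchy_convergent_iff convergent_LIMSEQ_iff)
  have bound: "integrable M (\<lambda>x. s n x - f x) \<and> (LINT x|M. norm (s n x - f x)) \<le> e"
    if e: "e > 0" and N: "\<forall>i\<ge>N. \<forall>j\<ge>N. (LINT x|M. norm (s i x - s j x)) < e" and n: "n \<ge> N" for e N n
  proof -
    have le: "(\<integral>\<^sup>+ x. ennreal (norm (s n x - f x)) \<partial>M) \<le> ennreal e"
    proof -
      have "(\<integral>\<^sup>+ x. ennreal (norm (s n x - f x)) \<partial>M)
          = (\<integral>\<^sup>+ x. liminf (\<lambda>i. ennreal (norm (s n x - s (r i) x))) \<partial>M)"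
      proof (rule nn_integral_cong_AE, use conv in eventually_elim)
        fix x assume "(\<lambda>i. s (r i) x) \<longlonglongrightarrow> f x"
        then have "(\<lambda>i. ennreal (norm (s n x - s (r i) x))) \<longlonglongrightarrow> ennreal (norm (s n x - f x))"
          by (intro tendsto_intros)
        then show "ennreal (norm (s n x - f x)) = liminf (\<lambda>i. ennreal (norm (s n x - s (r i) x)))"
          by (intro lim_imp_Liminf[symmetric]) simp_all
      qed
      also have "\<dots> \<le> liminf (\<lambda>i. \<integral>\<^sup>+ x. ennreal (norm (s n x - s (r i) x)) \<partial>M)"
        by (rule nn_integral_liminf) auto
      also have "\<dots> \<le> ennreal e"
      proof (rule Liminf_le)
        show "\<forall>\<^sub>F i in sequentially. (\<integral>\<^sup>+ x. ennreal (norm (s n x - s (r i) x)) \<partial>M) \<le> ennreal e"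
        proof (rule eventually_sequentiallyI)
          fix i assume "i \<ge> N"
          then have "r i \<ge> N" using seq_suble[OF r(1), of i] by linarith
          then have "(LINT x|M. norm (s n x - s (r i) x)) < e" using N n by blast
          moreover have "(\<integral>\<^sup>+ x. ennreal (norm (s n x - s (r i) x)) \<partial>M)
              = ennreal (LINT x|M. norm (s n x - s (r i) x))"
            using s by (intro nn_integral_eq_integral) auto
          ultimately show "(\<integral>\<^sup>+ x. ennreal (norm (s n x - s (r i) x)) \<partial>M) \<le> ennreal e"
            by (simp add: ennreal_leI)
        qed
      qed simp
      finally show ?thesis .
    qed
    have int: "integrable M (\<lambda>x. s n x - f x)"
      unfolding integrable_iff_bounded using le by (auto intro: le_less_trans)
    have "ennreal (LINT x|M. norm (s n x - f x)) = (\<integral>\<^sup>+ x. ennreal (norm (s n x - f x)) \<partial>M)"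
      using int by (intro nn_integral_eq_integral[symmetric]) auto
    then have "ennreal (LINT x|M. norm (s n x - f x)) \<le> ennreal e"
      using le by simp
    then show ?thesis using int e by (simp add: ennreal_le_iff)
  qed
  show ?thesis
  proof
    obtain N where "\<forall>i\<ge>N. \<forall>j\<ge>N. (LINT x|M. norm (s i x - s j x)) < 1"
      using Cauchy[of 1] by auto
    then have "integrable M (\<lambda>x. s N x - f x)" using bound[of 1 N N] by auto
    then have "integrable M (\<lambda>x. s N x - (s N x - f x))"
      by (rule Bochner_Integration.integrable_diff[OF s])
    then show "integrable M f" by simp
    show "(\<lambda>n. LINT x|M. norm (s n x - f x)) \<longlonglongrightarrow> 0"
    proof (rule LIMSEQ_I)
      fix e :: real assume "e > 0"
      then obtain N where N: "\<forall>i\<ge>N. \<forall>j\<ge>N. (LINT x|M. norm (s i x - s j x)) < e/2"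
        using Cauchy[of "e/2"] by auto
      have "norm ((LINT x|M. norm (s n x - f x)) - 0) < e" if "n \<ge> N" for n
        using bound[OF _ N that] \<open>e > 0\<close> by simp
      then show "\<exists>N. \<forall>n\<ge>N. norm ((LINT x|M. norm (s n x - f x)) - 0) < e" by blast
    qed
  qed
qed

lemma tendsto_integral_of_L1:
  fixes s :: "nat \<Rightarrow> 'a \<Rightarrow> 'b::{banach, second_countable_topology}"
    and T :: "'a \<Rightarrow> 'b \<Rightarrow> real"
  assumes lim: "(\<lambda>n. LINT x|M. norm (s n x - f x)) \<longlonglongrightarrow> 0"
    and int: "\<And>n. integrable M (s n)" "integrable M f"
    and T: "\<And>n. integrable M (\<lambda>x. T x (s n x))" "integrable M (\<lambda>x. T x (f x))"
    and C: "\<And>x u v. \<bar>T x u - T x v\<bar> \<le> C * norm (u - v)"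
  shows "(\<lambda>n. LINT x|M. T x (s n x)) \<longlonglongrightarrow> (LINT x|M. T x (f x))"
proof (rule LIM_zero_cancel, rule Lim_null_comparison)
  have "\<bar>(LINT x|M. T x (s n x)) - (LINT x|M. T x (f x))\<bar> \<le> C * (LINT x|M. norm (s n x - f x))" for n
  proof -
    have "(LINT x|M. T x (s n x)) - (LINT x|M. T x (f x)) = (LINT x|M. T x (s n x) - T x (f x))"
      using T by simp
    also have "\<bar>\<dots>\<bar> \<le> (LINT x|M. \<bar>T x (s n x) - T x (f x)\<bar>)" by (rule integral_abs_bound)
    also have "\<dots> \<le> (LINT x|M. C * norm (s n x - f x))"
      using T int C by (intro integral_mono) auto
    finally show ?thesis by simp
  qed
  then show "\<forall>\<^sub>F n in sequentially. norm ((LINT x|M. T x (s n x)) - (LINT x|M. T x (f x)))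
      \<le> C * (LINT x|M. norm (s n x - f x))"
    by simp
  show "(\<lambda>n. C * (LINT x|M. norm (s n x - f x))) \<longlonglongrightarrow> 0"
    using tendsto_mult_left[OF lim, of C] by simp
qed

lemma sobolev_eq_refl: "sobolev_fun f \<Longrightarrow> sobolev_eq f f"
  by (simp add: sobolev_eq_def)

lemma norm_abs_W11: "sobolev_fun f \<Longrightarrow> norm (abs_W11 f) = sobolev_norm f"
  by (simp add: norm_W11.abs_eq sobolev_eq_refl)

lemma minus_abs_W11:
  assumes "sobolev_fun f" "sobolev_fun g"
  shows "abs_W11 f - abs_W11 g = abs_W11 (\<lambda>x. f x - g x)"
proof -
  have "- abs_W11 g = abs_W11 (\<lambda>x. -1 * g x)"
    unfolding uminus_W11_def by (rule scaleR_W11.abs_eq[OF sobolev_eq_refl[OF assms(2)]])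
  then have "abs_W11 f - abs_W11 g = abs_W11 f + abs_W11 (\<lambda>x. -1 * g x)"
    by (simp only: minus_W11_def)
  also have "\<dots> = abs_W11 (\<lambda>x. f x + -1 * g x)"
    using assms by (intro plus_W11.abs_eq sobolev_eq_refl sobolev_fun_scale)
  finally show ?thesis by simp
qed

lemma abs_W11_cases:
  obtains f where "sobolev_fun f" "X = abs_W11 f"
proof (induction X rule: W11.abs_induct)
  case (1 f)
  then show ?case using sobolev_eq_def by blast
qed

instance W11 :: banach
proof
  fix X :: "nat \<Rightarrow> W11"
  assume "Cauchy X"
  have "\<exists>f. \<forall>n. sobolev_fun (f n) \<and> X n = abs_W11 (f n)"
    by (intro choice allI) (metis abs_W11_cases)
  then obtain f where f: "\<And>n. sobolev_fun (f n)" "\<And>n. X n = abs_W11 (f n)" by blast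
  define g where "g n = weak_gradient (f n)" for n
  have g: "is_weak_gradient (f n) (g n)" for n unfolding g_def by (rule weak_gradient[OF f(1)])
  have fi: "integrable lebesgue (f n)" for n using f(1) by (simp add: sobolev_fun_def)
  have gi: "integrable lebesgue (g n)" for n using g by (rule is_weak_gradient_integrable)
  have diff: "is_weak_gradient (\<lambda>x. u x - u' x) (\<lambda>x. v x - v' x)"
    if "integrable lebesgue u" "is_weak_gradient u v" "integrable lebesgue u'" "is_weak_gradient u' v'"
    for u u' v v'
    using is_weak_gradient_add[OF that(1,2) _ is_weak_gradient_scale[OF that(4), of "-1"]] that(3)
    by simp
  have dist: "dist (abs_W11 u) (abs_W11 u')
      = (LINT x|lebesgue. norm (u x - u' x)) + (LINT x|lebesgue. norm (v x - v' x))"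
    if "integrable lebesgue u" "is_weak_gradient u v" "integrable lebesgue u'" "is_weak_gradient u' v'"
    for u u' v v'
  proof -
    have s: "sobolev_fun u" "sobolev_fun u'" "sobolev_fun (\<lambda>x. u x - u' x)"
      using that diff[OF that] by (auto simp: sobolev_fun_def)
    show ?thesis
      using sobolev_norm_eq[OF diff[OF that]] s
      by (simp add: dist_norm minus_abs_W11 norm_abs_W11)
  qed
  have C: "\<exists>N. \<forall>i\<ge>N. \<forall>j\<ge>N. (LINT x|lebesgue. norm (f i x - f j x)) + (LINT x|lebesgue. norm (g i x - g j x)) < e"
    if "e > 0" for e
    using \<open>Cauchy X\<close> that unfolding Cauchy_def f(2) dist[OF fi g fi g] by blast
  have pos: "0 \<le> (LINT x|lebesgue. norm (f i x - f j x))" "0 \<le> (LINT x|lebesgue. norm (g i x - g j x))" for i j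
    by auto
  have "\<exists>N. \<forall>i\<ge>N. \<forall>j\<ge>N. (LINT x|lebesgue. norm (f i x - f j x)) < e" if "e > 0" for e
    using C[OF that] pos(2) by (meson add_increasing2 le_less_trans order_refl)
  then obtain F where F: "integrable lebesgue F" "(\<lambda>n. LINT x|lebesgue. norm (f n x - F x)) \<longlonglongrightarrow> 0"
    using L1_complete[of lebesgue f] fi by blast
  have "\<exists>N. \<forall>i\<ge>N. \<forall>j\<ge>N. (LINT x|lebesgue. norm (g i x - g j x)) < e" if "e > 0" for e
    using C[OF that] pos(1) by (meson add_increasing le_less_trans order_refl)
  then obtain G where G: "integrable lebesgue G" "(\<lambda>n. LINT x|lebesgue. norm (g n x - G x)) \<longlonglongrightarrow> 0"
    using L1_complete[of lebesgue g] gi by blast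
  have FG: "is_weak_gradient F G"
    unfolding is_weak_gradient_def
  proof (intro conjI allI impI G(1))
    fix \<phi> assume \<phi>: "test_field \<phi>"
    obtain C where C: "\<And>x. norm (divergence \<phi> x) \<le> C" using divergence_bounded[OF \<phi>] by blast
    have 1: "(\<lambda>n. LINT x|lebesgue. f n x * divergence \<phi> x) \<longlonglongrightarrow> (LINT x|lebesgue. F x * divergence \<phi> x)"
    proof (rule tendsto_integral_of_L1[OF F(2) fi F(1), where C = C])
      show "\<bar>u * divergence \<phi> x - v * divergence \<phi> x\<bar> \<le> C * norm (u - v)" for x u v
        using mult_right_mono[OF C[of x], of "\<bar>u - v\<bar>"]
        by (simp add: left_diff_distrib[symmetric] abs_mult mult.commute)
    qed (intro integrable_mult_divergence fi F \<phi>)+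
    obtain D where D: "\<And>x. norm (\<phi> x) \<le> D" using test_field_bounded[OF \<phi>] by blast
    have 2: "(\<lambda>n. LINT x|lebesgue. g n x \<bullet> \<phi> x) \<longlonglongrightarrow> (LINT x|lebesgue. G x \<bullet> \<phi> x)"
    proof (rule tendsto_integral_of_L1[OF G(2) gi G(1), where C = D])
      show "\<bar>u \<bullet> \<phi> x - v \<bullet> \<phi> x\<bar> \<le> D * norm (u - v)" for x u v
      proof -
        have "\<bar>(u - v) \<bullet> \<phi> x\<bar> \<le> norm (u - v) * norm (\<phi> x)" by (rule Cauchy_Schwarz_ineq2)
        also have "\<dots> \<le> norm (u - v) * D" using D by (intro mult_left_mono) auto
        finally show ?thesis by (simp add: inner_diff_left mult.commute)
      qed
    qed (intro integrable_inner_test_field gi G \<phi>)+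
    show "(LINT x|lebesgue. F x * divergence \<phi> x) = - (LINT x|lebesgue. G x \<bullet> \<phi> x)"
      using LIMSEQ_unique[OF 1] tendsto_minus[OF 2] is_weak_gradient_eq[OF g \<phi>] by simp
  qed
  have "(\<lambda>n. dist (X n) (abs_W11 F)) \<longlonglongrightarrow> 0"
    unfolding f(2) dist[OF fi g F(1) FG] using tendsto_add[OF F(2) G(2)] by simp
  then show "convergent X"
    unfolding convergent_def by (intro exI[of _ "abs_W11 F"]) (subst tendsto_dist_iff)
qed


section \<open>The slice diameter two property\<close>

definition slice :: "'a::real_normed_vector set \<Rightarrow> ('a \<Rightarrow>\<^sub>L real) \<Rightarrow> real \<Rightarrow> 'a set" where
  "slice B x' \<epsilon> = {x \<in> B. blinfun_apply x' x > 1 - \<epsilon>}"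

text \<open>Every slice is bounded and nonempty, so the library's \<open>diameter\<close> is here the genuine
  supremum of the distances.\<close>

definition slice_diameter_two_property :: "'a::real_normed_vector itself \<Rightarrow> bool" where
  "slice_diameter_two_property (X :: 'a itself) \<longleftrightarrow>
     (\<forall>(x' :: 'a \<Rightarrow>\<^sub>L real) \<epsilon>. norm x' = 1 \<and> \<epsilon> > 0 \<longrightarrow> diameter (slice (cball 0 1) x' \<epsilon>) = 2)"

end

theory Submission
  imports Defs
begin

text \<open>
  \<^emph>\<open>Idea.\<close> Normalised indicators of discs are extreme in the unit ball of \<open>BV\<close>. A functional
  peaking at such an indicator cuts out a slice of the ball of \<open>W\<^sup>1\<^sup>,\<^sup>1\<close> whose members
  all resemble the indicator in \<open>L\<^sup>1\<close>. Their gradients may be mutually singular, so the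
  slice need not be small; but because the \<open>L\<^sup>1\<close> part of the norm of a difference is partly
  cancelled, two members stay at distance at most \<open>2 - \<epsilon>\<close>.

  \<^emph>\<open>The functional.\<close> Let \<open>v\<close> be a radial inward vector field with \<open>norm v \<le> 1\<close> everywhere, equality
  holding exactly on the unit circle, and let \<open>T f\<close> be the integral of \<open>f\<close> over the unit disc plus
  the integral of \<open>\<nabla>f \<bullet> v\<close>. Each summand is dominated by the corresponding summand of the Sobolev
  norm, so \<open>T\<close> has norm at most one, and radial functions which drop from 1 to 0 just inside the unit
  circle show that the norm equals one (\<open>norm_calibration_functional\<close>). Integration by parts turns
  \<open>T\<close> into integration against a bounded function, the \<open>calibration_kernel\<close>.

  \<^emph>\<open>The slice.\<close> If \<open>norm f \<le> 1\<close> and \<open>T f > 1 - \<epsilon>\<close>, then both inequalities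
  are sharp up to \<open>\<epsilon>\<close>. Hence \<open>f\<close> is nearly nonnegative and nearly supported in the disc, while
  \<open>\<nabla>f\<close> has mass \<open>O(\<epsilon>)\<close> where \<open>norm v\<close> is bounded away from one, in particular on a small
  square about the origin, and is aligned with \<open>v\<close> up to an error of mass \<open>O(\<epsilon>)\<close>. Two consequences are needed.
  First, since the gradient points inward, mass cannot accumulate away from the origin: testing with
  a second radial field bounds the integral of \<open>f\<close> against a bump function on the square from below
  (\<open>bump_mass_near_maximizer\<close>). Secondly, a weighted Poincare inequality (\<open>weighted_poincare\<close>)
  shows that the difference of two members is nearly constant on the square; as both have at least
  the mass \<open>m\<close> there, the \<open>L\<^sup>1\<close> norm of the difference falls short of the sum of the norms by
  nearly \<open>2 * m\<close> (\<open>near_maximizers_close\<close>).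

  \<^emph>\<open>The Poincare inequality.\<close> It is proved by duality. For a finite sum \<open>\<psi>\<close> of products
  \<open>A (x $ 1) * B (x $ 2)\<close> that is dominated by the bump, replacing \<open>\<psi>\<close> by its average in one coordinate,
  spread out again along the bump, changes \<open>\<psi>\<close> by a partial derivative of a bounded function
  supported in the square. Averaging in both coordinates leaves a multiple of the bump. Such \<open>\<psi>\<close>
  approximate the sign of \<open>f\<close> times the bump, by the Stone-Weierstrass theorem.
\<close>

section \<open>Continuously differentiable functions and integration by parts\<close>

definition C1_gradient :: "(real^2 \<Rightarrow> real) \<Rightarrow> (real^2 \<Rightarrow> real^2) \<Rightarrow> bool" where
  "C1_gradient \<psi> d \<longleftrightarrow>
     continuous_on UNIV d \<and> (\<forall>x. (\<psi> has_derivative (\<lambda>h. d x \<bullet> h)) (at x))"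

lemma C1_fun_iff: "C1_fun \<psi> \<longleftrightarrow> (\<exists>d. C1_gradient \<psi> d)"
  by (simp add: C1_fun_def C1_gradient_def)

lemma C1_gradient_derivative:
  "C1_gradient \<psi> d \<Longrightarrow> (\<psi> has_derivative (\<lambda>h. d x \<bullet> h)) (at x)"
  by (simp add: C1_gradient_def)

lemma C1_gradient_continuous:
  assumes "C1_gradient \<psi> d"
  shows "continuous_on UNIV \<psi>" "continuous_on UNIV d"
  using assms C1_fun_continuous C1_fun_iff C1_gradient_def by blast+

lemma C1_gradient_unique:
  assumes "C1_gradient \<psi> d" "(\<psi> has_derivative (\<lambda>h. e \<bullet> h)) (at x)"
  shows "d x = e"
proof -
  have "(\<lambda>h. d x \<bullet> h) = (\<lambda>h. e \<bullet> h)"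
    using has_derivative_unique[OF C1_gradient_derivative[OF assms(1)] assms(2)] .
  then have "(d x - e) \<bullet> (d x - e) = 0"
    by (metis inner_diff_left right_minus_eq)
  then show ?thesis by simp
qed

lemma C1_gradient_outside:
  assumes "C1_gradient \<psi> d" "open U" "x \<in> U" "\<And>y. y \<in> U \<Longrightarrow> \<psi> y = 0"
  shows "d x = 0"
proof (rule C1_gradient_unique[OF assms(1)])
  have "((\<lambda>y. 0) has_derivative (\<lambda>h. 0)) (at x)" by simp
  then have "(\<psi> has_derivative (\<lambda>h. 0)) (at x)"
    by (rule has_derivative_transform_within_open[OF _ assms(2,3)]) (simp add: assms(4))
  then show "(\<psi> has_derivative (\<bullet>) 0) (at x)" by (simp add: inner_zero_left[abs_def])
qed

lemma C1_gradient_mult: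
  assumes "C1_gradient f d" "C1_gradient g e"
  shows "C1_gradient (\<lambda>x. f x * g x) (\<lambda>x. f x *\<^sub>R e x + g x *\<^sub>R d x)"
  unfolding C1_gradient_def
proof (intro conjI allI)
  show "continuous_on UNIV (\<lambda>x. f x *\<^sub>R e x + g x *\<^sub>R d x)"
    by (intro continuous_intros C1_gradient_continuous[OF assms(1)] C1_gradient_continuous[OF assms(2)])
  show "((\<lambda>x. f x * g x) has_derivative (\<bullet>) (f x *\<^sub>R e x + g x *\<^sub>R d x)) (at x)" for x
    by (rule has_derivative_eq_rhs[OF has_derivative_mult[OF
          C1_gradient_derivative[OF assms(1)] C1_gradient_derivative[OF assms(2)]]])
       (auto simp: inner_add_left)
qed

lemma C1_gradient_coord:
  assumes "\<And>t. (A has_real_derivative A' t) (at t)" "continuous_on UNIV A'"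
  shows "C1_gradient (\<lambda>x. A (x $ i)) (\<lambda>x. A' (x $ i) *\<^sub>R axis i 1)"
  unfolding C1_gradient_def
proof (intro conjI allI)
  show "continuous_on UNIV (\<lambda>x. A' (x $ i) *\<^sub>R (axis i 1 :: real^2))"
    by (intro continuous_intros continuous_on_compose2[OF assms(2)]) auto
  fix x :: "real^2"
  have "((\<lambda>x. x $ i) has_derivative (\<lambda>h. h $ i)) (at x)"
    by (simp add: bounded_linear_imp_has_derivative bounded_linear_vec_nth)
  from has_derivative_compose[OF this assms(1)[unfolded has_field_derivative_def]]
  show "((\<lambda>x. A (x $ i)) has_derivative (\<bullet>) (A' (x $ i) *\<^sub>R axis i 1)) (at x)"
    by (rule has_derivative_eq_rhs) (simp add: inner_axis' fun_eq_iff)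
qed

lemma C1_gradient_sum_squares:
  assumes "\<And>t. t \<ge> 0 \<Longrightarrow> (P has_real_derivative P' t) (at t)" "continuous_on {0..} P'"
  shows "C1_gradient (\<lambda>x. P (x \<bullet> x)) (\<lambda>x. (2 * P' (x \<bullet> x)) *\<^sub>R x)"
  unfolding C1_gradient_def
proof (intro conjI allI)
  show "continuous_on UNIV (\<lambda>x::real^2. (2 * P' (x \<bullet> x)) *\<^sub>R x)"
    by (intro continuous_intros continuous_on_compose2[OF assms(2)]) auto
  fix x :: "real^2"
  have "((\<lambda>x. x \<bullet> x) has_derivative (\<lambda>h. x \<bullet> h + h \<bullet> x)) (at x)"
    by (intro derivative_intros)
  from has_derivative_compose[OF this assms(1)[unfolded has_field_derivative_def]]
  show "((\<lambda>x. P (x \<bullet> x)) has_derivative (\<bullet>) ((2 * P' (x \<bullet> x)) *\<^sub>R x)) (at x)"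
    by (rule has_derivative_eq_rhs) (simp_all add: inner_commute algebra_simps fun_eq_iff)
qed

lemma C1_gradient_bounds:
  assumes "C1_gradient \<psi> d" "bounded {x. \<psi> x \<noteq> 0}"
  obtains C R where "\<And>x. norm (d x) \<le> C" "R > 0" "\<And>x. norm x > R \<Longrightarrow> \<psi> x = 0 \<and> d x = 0"
proof -
  obtain R where R: "R > 0" "\<And>x. \<psi> x \<noteq> 0 \<Longrightarrow> norm x \<le> R"
    using assms(2) by (auto simp: bounded_pos)
  have out: "\<psi> x = 0 \<and> d x = 0" if "norm x > R" for x
  proof
    show "d x = 0"
    proof (rule C1_gradient_outside[OF assms(1)])
      show "open (- cball 0 R :: (real^2) set)" by auto
      show "\<psi> y = 0" if "y \<in> - cball 0 R" for y using that R(2)[of y] by force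
    qed (use that in auto)
  qed (use that R(2)[of x] in force)
  obtain C where "\<And>x. norm (d x) \<le> C"
  proof (rule bounded_of_compact_support[OF C1_gradient_continuous(2)[OF assms(1)]])
    show "compact (cball 0 R :: (real^2) set)" by simp
    show "d x = 0" if "x \<notin> cball 0 R" for x using that out by auto
  qed auto
  then show ?thesis using R out that by blast
qed

lemma integrable_continuous_compact_support:
  fixes f :: "real^2 \<Rightarrow> 'b::euclidean_space"
  assumes "continuous_on UNIV f" "\<And>x. norm x > R \<Longrightarrow> f x = 0"
  shows "integrable lebesgue f"
proof -
  have "integrable lborel (\<lambda>x. indicator (cball 0 R) x *\<^sub>R f x)"
    using borel_integrable_compact[of "cball 0 R" f] assms(1)
    by (simp add: continuous_on_subset[OF assms(1)])
  moreover have "(\<lambda>x. indicator (cball 0 R) x *\<^sub>R f x) = f"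
    using assms(2) by (auto simp: indicator_def)
  ultimately show ?thesis
    using borel_measurable_continuous_onI[OF assms(1)] by (simp add: integrable_completion)
qed

text \<open>Translation invariance of Lebesgue measure: the difference quotients of \<open>\<psi>\<close> in a coordinate
  direction all have integral zero, and they converge dominatedly to the partial derivative.\<close>

lemma integral_partial_derivative_zero:
  assumes "C1_gradient \<psi> d" "bounded {x. \<psi> x \<noteq> 0}"
  shows "(LINT x|lebesgue. d x $ i) = 0"
proof -
  let ?e = "axis i 1 :: real^2"
  obtain C R where C: "\<And>x. norm (d x) \<le> C" and R: "R > 0" "\<And>x. norm x > R \<Longrightarrow> \<psi> x = 0 \<and> d x = 0"
    using C1_gradient_bounds[OF assms] by blast
  have C0: "C \<ge> 0" using C[of 0] norm_ge_zero order_trans by blast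
  note cont = C1_gradient_continuous[OF assms(1)]
  have [measurable]: "\<psi> \<in> borel_measurable borel" "(\<lambda>x. d x $ i) \<in> borel_measurable borel"
    by (intro borel_measurable_continuous_onI continuous_intros cont)+
  define D where "D n x = (\<psi> (x + (1 / real (Suc n)) *\<^sub>R ?e) - \<psi> x) * real (Suc n)" for n x
  have lim: "(\<lambda>n. D n x) \<longlonglongrightarrow> d x $ i" for x
  proof -
    have "((\<lambda>t. x + t *\<^sub>R ?e) has_derivative (\<lambda>t. t *\<^sub>R ?e)) (at 0)"
      by (auto intro!: derivative_eq_intros)
    moreover have "(\<psi> has_derivative (\<lambda>h. d x \<bullet> h)) (at (x + 0 *\<^sub>R ?e))"
      using C1_gradient_derivative[OF assms(1)] by simp
    ultimately have "((\<lambda>t. \<psi> (x + t *\<^sub>R ?e)) has_derivative (\<lambda>t. d x \<bullet> (t *\<^sub>R ?e))) (at 0)"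
      by (rule has_derivative_compose)
    then have "((\<lambda>t. \<psi> (x + t *\<^sub>R ?e)) has_real_derivative d x $ i) (at 0)"
      by (rule has_derivative_imp_has_field_derivative) (simp add: inner_axis)
    then have "((\<lambda>t. (\<psi> (x + t *\<^sub>R ?e) - \<psi> x) / t) \<longlongrightarrow> d x $ i) (at 0)"
      by (simp add: DERIV_def)
    moreover have "filterlim (\<lambda>n. 1 / real (Suc n)) (at 0) sequentially"
      unfolding filterlim_at using LIMSEQ_inverse_real_of_nat
      by (auto simp: inverse_eq_divide)
    ultimately have "((\<lambda>n. (\<psi> (x + (1 / real (Suc n)) *\<^sub>R ?e) - \<psi> x) / (1 / real (Suc n))) \<longlongrightarrow> d x $ i) sequentially"
      by (rule filterlim_compose)
    then show ?thesis by (simp add: D_def)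
  qed
  have bound: "\<bar>D n x\<bar> \<le> C * indicator (cball 0 (R + 1)) x" for n x
  proof (cases "x \<in> cball 0 (R + 1)")
    case True
    have "norm (\<psi> (x + (1 / real (Suc n)) *\<^sub>R ?e) - \<psi> x) \<le> C * norm (x + (1 / real (Suc n)) *\<^sub>R ?e - x)"
    proof (rule differentiable_bound[of UNIV])
      show "(\<psi> has_derivative (\<lambda>h. d y \<bullet> h)) (at y within UNIV)" for y
        using C1_gradient_derivative[OF assms(1)] by simp
      show "onorm (\<lambda>h. d y \<bullet> h) \<le> C" for y
        using order_trans[OF Cauchy_Schwarz_ineq2 mult_right_mono[OF C]]
        by (intro onorm_bound C0) (simp add: order_trans)
    qed auto
    then have "\<bar>\<psi> (x + (1 / real (Suc n)) *\<^sub>R ?e) - \<psi> x\<bar> * real (Suc n)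
       \<le> C * (1 / real (Suc n)) * real (Suc n)"
      by (intro mult_right_mono) (auto simp: norm_axis_1)
    then show ?thesis using True by (simp add: D_def abs_mult)
  next
    case False
    have "norm x \<le> norm (x + (1 / real (Suc n)) *\<^sub>R ?e) + norm ((1 / real (Suc n)) *\<^sub>R ?e)"
      by (metis add_diff_cancel_right' norm_triangle_ineq4)
    moreover have "norm ((1 / real (Suc n)) *\<^sub>R ?e) \<le> 1" by (simp add: norm_axis_1)
    ultimately have "R < norm (x + (1 / real (Suc n)) *\<^sub>R ?e)" "R < norm x"
      using False R(1) by (simp_all del: norm_scaleR)
    then have "\<psi> (x + (1 / real (Suc n)) *\<^sub>R ?e) = 0" "\<psi> x = 0"
      using R(2) by blast+
    then show ?thesis by (simp add: D_def C0)
  qed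
  have int: "integrable lborel \<psi>"
    using integrable_continuous_compact_support[OF cont(1)] R(2) by (auto simp: integrable_completion)
  have shift: "integrable lborel (\<lambda>x. \<psi> (x + a))" "(LINT x|lborel. \<psi> (x + a)) = (LINT x|lborel. \<psi> x)" for a
  proof -
    have eq: "distr lborel borel (\<lambda>x. x + a) = lborel"
      using lborel_distr_plus[of a] by (subst add.commute) simp
    show "integrable lborel (\<lambda>x. \<psi> (x + a))"
      using int integrable_distr_eq[of "\<lambda>x. x + a" lborel borel \<psi>] eq by simp
    show "(LINT x|lborel. \<psi> (x + a)) = (LINT x|lborel. \<psi> x)"
      using integral_distr[of "\<lambda>x. x + a" lborel borel \<psi>] eq by simp
  qed
  have zero: "(LINT x|lborel. D n x) = 0" for n
    using shift int by (simp add: D_def)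
  have "(\<lambda>n. LINT x|lborel. D n x) \<longlonglongrightarrow> (LINT x|lborel. d x $ i)"
  proof (rule integral_dominated_convergence[where w = "\<lambda>x. C * indicator (cball 0 (R + 1)) x"])
    show "integrable lborel (\<lambda>x::real^2. C * indicator (cball 0 (R + 1)) x :: real)"
      using emeasure_bounded_finite[OF bounded_cball[of "0::real^2" "R + 1"]]
      by (intro integrable_mult_right integrable_real_indicator) auto
  qed (use lim bound in \<open>auto simp: D_def\<close>)
  then have "(LINT x|lborel. d x $ i) = 0"
    by (simp add: zero LIMSEQ_const_iff)
  then show ?thesis by (subst integral_completion) auto
qed

lemma weak_gradient_integral_by_parts:
  assumes "is_weak_gradient f g" "C1_gradient \<psi> d" "bounded {x. \<psi> x \<noteq> 0}"
  shows "(LINT x|lebesgue. f x * d x $ i) = - (LINT x|lebesgue. g x $ i * \<psi> x)"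
proof -
  let ?\<phi> = "\<lambda>x. \<psi> x *\<^sub>R axis i 1 :: real^2"
  have t: "test_field ?\<phi>"
    using assms(2,3) C1_fun_iff by (blast intro: test_field_of_C1_fun)
  have "(?\<phi> has_derivative (\<lambda>h. (d x \<bullet> h) *\<^sub>R axis i 1)) (at x)" for x
    using C1_gradient_derivative[OF assms(2)] by (rule has_derivative_scaleR_left)
  then have F: "frechet_derivative ?\<phi> (at x) = (\<lambda>h. (d x \<bullet> h) *\<^sub>R axis i 1)" for x
    by (metis frechet_derivative_at)
  have "(\<Sum>j\<in>UNIV. d x $ j * axis i 1 $ j) = d x $ i" for x
    by (simp add: axis_def if_distrib cong: if_cong)
  then have "divergence ?\<phi> x = d x $ i" for x
    by (simp add: divergence_def jacobian_def F matrix_def trace_def inner_axis)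
  then show ?thesis
    using is_weak_gradient_eq[OF assms(1) t] by (simp add: inner_axis mult.commute)
qed

text \<open>For a test field \<open>\<phi>\<close> the function \<open>f x * divergence \<phi> x + g x \<bullet> \<phi> x\<close> is the divergence of the
  compactly supported field \<open>f x *\<^sub>R \<phi> x\<close>, hence has integral zero.\<close>

lemma C1_gradient_is_weak_gradient:
  assumes f: "C1_gradient f g" "bounded {x. f x \<noteq> 0}"
  shows "integrable lebesgue f" "is_weak_gradient f g"
proof -
  obtain C R where R: "\<And>x. norm x > R \<Longrightarrow> f x = 0 \<and> g x = 0"
    using C1_gradient_bounds[OF assms] by metis
  note cf = C1_gradient_continuous[OF f(1)]
  show "integrable lebesgue f"
    by (rule integrable_continuous_compact_support[OF cf(1)]) (use R in blast)
  have ig: "integrable lebesgue g"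
    by (rule integrable_continuous_compact_support[OF cf(2)]) (use R in blast)
  show "is_weak_gradient f g"
    unfolding is_weak_gradient_def
  proof (intro conjI allI impI ig)
    fix \<phi> assume \<phi>: "test_field \<phi>"
    define J where "J x = jacobian \<phi> (at x)" for x
    have J: "continuous_on UNIV J" using \<phi> by (simp add: test_field_def J_def[abs_def])
    have c\<phi>: "continuous_on UNIV \<phi>" by (rule test_field_continuous[OF \<phi>])
    have \<phi>J: "C1_gradient (\<lambda>x. \<phi> x $ i) (\<lambda>x. J x $ i)" for i
      unfolding C1_gradient_def
    proof (intro conjI allI)
      show "continuous_on UNIV (\<lambda>x. J x $ i)" using J by (intro continuous_intros)
      fix x
      have "(\<phi> has_derivative (\<lambda>h. J x *v h)) (at x)"
        using \<phi> jacobian_works[of \<phi> "at x"] by (simp add: test_field_def J_def)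
      from bounded_linear.has_derivative[OF bounded_linear_vec_nth this]
      show "((\<lambda>x. \<phi> x $ i) has_derivative (\<bullet>) (J x $ i)) (at x)"
        by (simp add: matrix_vector_mul_component)
    qed
    have zero: "(LINT x|lebesgue. f x * J x $ i $ i + \<phi> x $ i * g x $ i) = 0" for i
    proof -
      have "(LINT x|lebesgue. (f x *\<^sub>R J x $ i + \<phi> x $ i *\<^sub>R g x) $ i) = 0"
        by (rule integral_partial_derivative_zero[OF C1_gradient_mult[OF f(1) \<phi>J]])
           (rule bounded_subset[OF f(2)], auto)
      then show ?thesis by simp
    qed
    have int: "integrable lebesgue (\<lambda>x. f x * J x $ i $ i)" "integrable lebesgue (\<lambda>x. \<phi> x $ i * g x $ i)" for i
      by (rule integrable_continuous_compact_support[where R = R],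
          intro continuous_intros cf J c\<phi>, simp add: R)+
    have "(LINT x|lebesgue. f x * divergence \<phi> x) = (LINT x|lebesgue. (\<Sum>i\<in>UNIV. f x * J x $ i $ i))"
      by (simp add: divergence_def trace_def J_def sum_distrib_left)
    also have "\<dots> = (\<Sum>i\<in>UNIV. LINT x|lebesgue. f x * J x $ i $ i)"
      using int by (intro Bochner_Integration.integral_sum) auto
    also have "\<dots> = (\<Sum>i\<in>UNIV. - (LINT x|lebesgue. \<phi> x $ i * g x $ i))"
      using zero int by (intro sum.cong) (auto simp: eq_neg_iff_add_eq_0)
    also have "\<dots> = - (LINT x|lebesgue. (\<Sum>i\<in>UNIV. \<phi> x $ i * g x $ i))"
      using int by (simp add: sum_negf)
    also have "(\<lambda>x. \<Sum>i\<in>UNIV. \<phi> x $ i * g x $ i) = (\<lambda>x. g x \<bullet> \<phi> x)"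
      by (simp add: inner_vec_def mult.commute)
    finally show "(LINT x|lebesgue. f x * divergence \<phi> x) = - (LINT x|lebesgue. g x \<bullet> \<phi> x)" .
  qed
qed

section \<open>The bump function and separable functions\<close>

definition C1_real :: "(real \<Rightarrow> real) \<Rightarrow> bool" where
  "C1_real A \<longleftrightarrow> (\<exists>A'. continuous_on UNIV A' \<and> (\<forall>t. (A has_real_derivative A' t) (at t)))"

lemma C1_real_continuous: "C1_real A \<Longrightarrow> continuous_on UNIV A"
  unfolding C1_real_def by (meson DERIV_isCont continuous_at_imp_continuous_on)

lemma C1_real_const: "C1_real (\<lambda>t. c)"
  unfolding C1_real_def by (intro exI[of _ "\<lambda>t. 0"]) auto

lemma C1_real_scale: "C1_real (\<lambda>t. c * t)"
  unfolding C1_real_def by (intro exI[of _ "\<lambda>t. c"]) (auto intro!: derivative_eq_intros)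

lemma C1_real_mult:
  assumes "C1_real A" "C1_real B"
  shows "C1_real (\<lambda>t. A t * B t)"
proof -
  obtain A' B' where "continuous_on UNIV A'" "\<And>t. (A has_real_derivative A' t) (at t)"
    "continuous_on UNIV B'" "\<And>t. (B has_real_derivative B' t) (at t)"
    using assms unfolding C1_real_def by blast
  moreover have "continuous_on UNIV A" "continuous_on UNIV B"
    using assms by (auto intro: C1_real_continuous)
  ultimately show ?thesis unfolding C1_real_def
    by (intro exI[of _ "\<lambda>t. A' t * B t + B' t * A t"])
       (auto intro!: DERIV_mult continuous_intros)
qed

lemma C1_real_intro:
  "(\<And>t. (A has_real_derivative A' t) (at t)) \<Longrightarrow> continuous_on UNIV A' \<Longrightarrow> C1_real A"
  by (auto simp: C1_real_def)

text \<open>The squared positive part keeps the function continuously differentiable at the ends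
  \<open>-1/4\<close> and \<open>1/4\<close> of its support.\<close>

definition cutoff :: "real \<Rightarrow> real" where
  "cutoff t = (max 0 (1 - 16 * t\<^sup>2))\<^sup>2"

definition bump :: "real^2 \<Rightarrow> real" where
  "bump x = cutoff (x $ 1) * cutoff (x $ 2)"

lemma C1_real_cutoff: "C1_real cutoff"
proof (rule C1_real_intro)
  show "(cutoff has_real_derivative 2 * max 0 (1 - 16 * t\<^sup>2) * (- (32 * t))) (at t)" for t
    unfolding cutoff_def[abs_def]
    by (rule DERIV_chain2[OF has_real_derivative_pos_part_sq]) (auto intro!: derivative_eq_intros)
  show "continuous_on UNIV (\<lambda>t. 2 * max 0 (1 - 16 * t\<^sup>2) * (- (32 * t :: real)))"
    by (intro continuous_intros)
qed

lemma cutoff_nonneg: "cutoff t \<ge> 0"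
  by (simp add: cutoff_def)

lemma cutoff_le_1: "cutoff t \<le> 1"
  unfolding cutoff_def by (rule power_le_one) auto

lemma cutoff_eq_0: "\<bar>t\<bar> \<ge> 1/4 \<Longrightarrow> cutoff t = 0"
proof -
  assume "\<bar>t\<bar> \<ge> 1/4"
  then have "(1/4)\<^sup>2 \<le> \<bar>t\<bar>\<^sup>2" by (intro power_mono) auto
  then show ?thesis by (simp add: cutoff_def power2_eq_square)
qed

lemma cutoff_ge:
  assumes "t\<^sup>2 \<le> 1/32"
  shows "cutoff t \<ge> 1/4"
proof -
  have "(1/2)\<^sup>2 \<le> (max 0 (1 - 16 * t\<^sup>2))\<^sup>2"
    using assms by (intro power_mono) auto
  then show ?thesis by (simp add: cutoff_def power2_eq_square)
qed

definition cutoff_mass :: real where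
  "cutoff_mass = integral {-1/4..1/4} cutoff"

lemma cutoff_integrable: "cutoff integrable_on {a..b}"
  by (intro integrable_continuous_real continuous_on_subset[OF C1_real_continuous[OF C1_real_cutoff]]) auto

lemma cutoff_mass_pos: "cutoff_mass > 0"
proof -
  have "cutoff_mass \<noteq> 0"
  proof
    assume "cutoff_mass = 0"
    then have "\<forall>t\<in>cbox (-1/4) (1/4). cutoff t = 0"
      unfolding cutoff_mass_def
      by (intro has_integral_0_cbox_imp_0[where f = cutoff] ballI)
         (use cutoff_integrable[of "-1/4" "1/4"] cutoff_nonneg
            C1_real_continuous[OF C1_real_cutoff, THEN continuous_on_subset] in
           \<open>auto simp: has_integral_iff\<close>)
    then have "cutoff 0 = 0" by auto
    then show False by (simp add: cutoff_def)
  qed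
  moreover have "cutoff_mass \<ge> 0"
    unfolding cutoff_mass_def by (intro integral_nonneg cutoff_integrable cutoff_nonneg)
  ultimately show ?thesis by simp
qed

text \<open>Subtracting the multiple of the cutoff with the same integral makes the total increment over
  \<open>{-1/4..1/4}\<close> vanish, so the antiderivative can be normalised to be zero at both ends.\<close>

lemma mean_free_antiderivative:
  assumes "continuous_on UNIV A"
  obtains G where "G (-1/4) = 0" "G (1/4) = 0"
    "\<And>t. (G has_real_derivative A t - cutoff t * (integral {-1/4..1/4} A / cutoff_mass)) (at t)"
proof -
  let ?f = "\<lambda>t. A t - cutoff t * (integral {-1/4..1/4} A / cutoff_mass)"
  have cont: "continuous_on UNIV ?f"
    by (intro continuous_intros assms C1_real_continuous[OF C1_real_cutoff])
  obtain H where H: "\<And>t. (H has_vector_derivative ?f t) (at t)"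
    using einterval_antiderivative[of "-\<infinity>" "\<infinity>" ?f] continuous_on_eq_continuous_at[of UNIV ?f] cont
    by auto
  let ?k = "integral {-1/4..1/4} A / cutoff_mass"
  have "A integrable_on {-1/4..1/4}"
    using assms by (intro integrable_continuous_real) (auto intro: continuous_on_subset)
  then have "(?f has_integral (integral {-1/4..1/4} A - cutoff_mass * ?k)) {-1/4..1/4}"
    unfolding cutoff_mass_def
    by (intro has_integral_diff has_integral_mult_left integrable_integral cutoff_integrable)
  moreover have "(?f has_integral (H (1/4) - H (-1/4))) {-1/4..1/4}"
    by (intro fundamental_theorem_of_calculus) (simp, rule has_vector_derivative_at_within[OF H])
  ultimately have "H (1/4) - H (-1/4) = integral {-1/4..1/4} A - cutoff_mass * ?k"
    by (intro has_integral_unique)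
  then have "H (1/4) = H (-1/4)" using cutoff_mass_pos by simp
  then show ?thesis
    using H by (intro that[of "\<lambda>t. H t - H (-1/4)"])
      (auto simp: has_real_derivative_iff_has_vector_derivative intro!: derivative_eq_intros)
qed

text \<open>These functions are closed under products, contain the polynomials, and are stable under
  integrating out one coordinate, where only one-dimensional antiderivatives are needed.\<close>

inductive separable :: "(real^2 \<Rightarrow> real) \<Rightarrow> bool" where
  prod: "C1_real A \<Longrightarrow> C1_real B \<Longrightarrow> separable (\<lambda>x. A (x $ 1) * B (x $ 2))"
| add: "separable f \<Longrightarrow> separable g \<Longrightarrow> separable (\<lambda>x. f x + g x)"

lemma separable_prod_coords:
  assumes "i \<noteq> j" "C1_real A" "C1_real B"
  shows "separable (\<lambda>x. A (x $ i) * B (x $ j))"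
proof -
  consider "i = 1" "j = 2" | "i = 2" "j = 1" using assms(1) exhaust_2 by metis
  then show ?thesis
  proof cases
    case 2
    then show ?thesis using separable.prod[OF assms(3,2)] by (simp add: mult.commute)
  qed (use separable.prod[OF assms(2,3)] in simp)
qed

lemma separable_induct_coords [consumes 2, case_names prod add]:
  assumes "separable \<psi>" "i \<noteq> j"
    and prod: "\<And>A B. C1_real A \<Longrightarrow> C1_real B \<Longrightarrow> P (\<lambda>x. A (x $ i) * B (x $ j))"
    and add: "\<And>f g. separable f \<Longrightarrow> separable g \<Longrightarrow> P f \<Longrightarrow> P g \<Longrightarrow> P (\<lambda>x. f x + g x)"
  shows "P \<psi>"
  using assms(1)
proof induction
  case (prod A B)
  consider "i = 1" "j = 2" | "i = 2" "j = 1" using assms(2) exhaust_2 by metis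
  then show ?case
  proof cases
    case 1 then show ?thesis using assms(3)[OF prod] by simp
  next
    case 2 then show ?thesis using assms(3)[OF prod(2,1)] by (simp add: mult.commute)
  qed
qed (rule add)

lemma separable_continuous:
  assumes "separable f"
  shows "continuous_on UNIV f"
  using assms
proof induction
  case (prod A B)
  then show ?case
    by (intro continuous_intros continuous_on_compose2[OF C1_real_continuous[of A]]
        continuous_on_compose2[OF C1_real_continuous[of B]]) auto
qed (auto intro: continuous_intros)

lemma separable_mult:
  assumes "separable f" "separable g"
  shows "separable (\<lambda>x. f x * g x)"
  using assms
proof (induction arbitrary: g)
  case f: (prod A B)
  from f(3) show ?case
  proof induction
    case (prod C D)
    have "separable (\<lambda>x. (A (x $ 1) * C (x $ 1)) * (B (x $ 2) * D (x $ 2)))"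
      using f prod by (intro separable.prod C1_real_mult)
    then show ?case by (simp add: algebra_simps)
  next
    case (add g h)
    then show ?case using separable.add by (fastforce simp: distrib_left)
  qed
next
  case (add f f')
  then show ?case using separable.add[of "\<lambda>x. f x * g x" "\<lambda>x. f' x * g x"] by (simp add: distrib_right)
qed

lemma separable_const: "separable (\<lambda>x. c)"
  using separable.prod[OF C1_real_const[of c] C1_real_const[of 1]] by simp

lemma separable_bump: "separable bump"
  unfolding bump_def[abs_def] by (intro separable.prod C1_real_cutoff)

lemma separable_real_polynomial_function:
  fixes p :: "real^2 \<Rightarrow> real"
  assumes "real_polynomial_function p"
  shows "separable p"
  using assms
proof induction
  case (linear f)
  then interpret bounded_linear f .
  have "f x = f (axis 1 1) * x $ 1 * 1 + 1 * (f (axis 2 1) * x $ 2)" for x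
  proof -
    have "x = x $ 1 *\<^sub>R axis 1 1 + x $ 2 *\<^sub>R axis 2 1"
      by (simp add: vec_eq_iff forall_2 axis_def)
    then show ?thesis by (metis add scaleR mult.commute mult_1 real_scaleR_def)
  qed
  then have "f = (\<lambda>x. f (axis 1 1) * x $ 1 * 1 + 1 * (f (axis 2 1) * x $ 2))" by blast
  moreover have "separable (\<lambda>x. f (axis 1 1) * x $ 1 * 1 + 1 * (f (axis 2 1) * x $ 2))"
    by (intro separable.add separable.prod[of "\<lambda>t. f (axis 1 1) * t" "\<lambda>t. 1"]
        separable.prod[of "\<lambda>t. 1" "\<lambda>t. f (axis 2 1) * t"] C1_real_scale C1_real_const)
  ultimately show ?case by simp
qed (auto intro: separable_const separable.add separable_mult)

section \<open>A weighted Poincare inequality\<close>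

definition with_coord :: "real^2 \<Rightarrow> 2 \<Rightarrow> real \<Rightarrow> real^2" where
  "with_coord x i t = (\<chi> k. if k = i then t else x $ k)"

lemma with_coord_nth [simp]: "with_coord x i t $ k = (if k = i then t else x $ k)"
  by (simp add: with_coord_def)

lemma with_coord_same [simp]: "with_coord x i (x $ i) = x"
  by (simp add: vec_eq_iff)

lemma with_coord_affine: "with_coord x i t = x + (t - x $ i) *\<^sub>R axis i 1"
  by (simp add: vec_eq_iff axis_def)

lemma continuous_with_coord: "continuous_on S (with_coord x i)"
  unfolding with_coord_affine[abs_def] by (intro continuous_intros)

text \<open>The mean in coordinate \<open>i\<close>, spread out along the cutoff in that coordinate: the result has the
  same integrals as \<open>\<psi>\<close> over the segments on which coordinate \<open>i\<close> runs through \<open>{-1/4..1/4}\<close>.\<close>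

definition average_out :: "2 \<Rightarrow> (real^2 \<Rightarrow> real) \<Rightarrow> real^2 \<Rightarrow> real" where
  "average_out i \<psi> x
     = cutoff (x $ i) * (integral {-1/4..1/4} (\<lambda>t. \<psi> (with_coord x i t)) / cutoff_mass)"

lemma separable_line_integrable:
  assumes "separable \<psi>"
  shows "(\<lambda>t. \<psi> (with_coord x i t)) integrable_on {a..b}"
  by (intro integrable_continuous_real
      continuous_on_compose2[OF separable_continuous[OF assms] continuous_with_coord]) auto

lemma average_out_add:
  assumes "separable f" "separable g"
  shows "average_out i (\<lambda>x. f x + g x) x = average_out i f x + average_out i g x"
  using separable_line_integrable[OF assms(1)] separable_line_integrable[OF assms(2)]
  by (simp add: average_out_def integral_add add_divide_distrib distrib_left)

lemma average_out_prod:
  assumes "i \<noteq> j"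
  shows "average_out i (\<lambda>x. A (x $ i) * B (x $ j)) x
    = cutoff (x $ i) * (integral {-1/4..1/4} A / cutoff_mass) * B (x $ j)"
  using assms by (auto simp: average_out_def)

lemma separable_average_out:
  assumes "separable \<psi>"
  shows "separable (average_out i \<psi>)"
proof -
  obtain j :: 2 where "i \<noteq> j" by (metis zero_neq_one)
  with assms show ?thesis
  proof (induction rule: separable_induct_coords)
    case (prod A B)
    have "separable (\<lambda>x. (cutoff (x $ i) * (integral {-1/4..1/4} A / cutoff_mass)) * B (x $ j))"
      using \<open>i \<noteq> j\<close> prod by (intro separable_prod_coords
          [of i j "\<lambda>t. cutoff t * (integral {-1/4..1/4} A / cutoff_mass)"] C1_real_mult C1_real_cutoff C1_real_const)
    then show ?case using average_out_prod[OF \<open>i \<noteq> j\<close>] by presburger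
  next
    case (add f g)
    then show ?case using separable.add[OF add(3,4)] average_out_add[OF add(1,2)] by presburger
  qed
qed

text \<open>The difference \<open>\<psi> - average_out i \<psi>\<close> has mean zero on every segment in direction \<open>i\<close>,
  so it is the partial derivative of a function vanishing at both ends.\<close>

lemma average_out_antiderivative:
  assumes "separable \<psi>"
  obtains w d where "C1_gradient w d" "\<And>x. d x $ i = \<psi> x - average_out i \<psi> x"
    "\<And>x. x $ i = -1/4 \<Longrightarrow> w x = 0" "\<And>x. x $ i = 1/4 \<Longrightarrow> w x = 0"
proof -
  obtain j :: 2 where ij: "i \<noteq> j" by (metis zero_neq_one)
  from assms ij have "\<exists>w d. C1_gradient w d \<and> (\<forall>x. d x $ i = \<psi> x - average_out i \<psi> x) \<and>
      (\<forall>x. x $ i = -1/4 \<or> x $ i = 1/4 \<longrightarrow> w x = 0)"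
  proof (induction rule: separable_induct_coords)
    case (prod A B)
    obtain B' where B': "continuous_on UNIV B'" "\<And>t. (B has_real_derivative B' t) (at t)"
      using prod(2) by (auto simp: C1_real_def)
    obtain G where G: "G (-1/4) = 0" "G (1/4) = 0"
      "\<And>t. (G has_real_derivative A t - cutoff t * (integral {-1/4..1/4} A / cutoff_mass)) (at t)"
      using mean_free_antiderivative[OF C1_real_continuous[OF prod(1)]] by blast
    have "C1_gradient (\<lambda>x. G (x $ i) * B (x $ j))
       (\<lambda>x. G (x $ i) *\<^sub>R B' (x $ j) *\<^sub>R axis j 1 +
          B (x $ j) *\<^sub>R (A (x $ i) - cutoff (x $ i) * (integral {-1/4..1/4} A / cutoff_mass)) *\<^sub>R axis i 1)"
      by (intro C1_gradient_mult C1_gradient_coord G(3) B' continuous_intros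
          C1_real_continuous[OF prod(1)] C1_real_continuous[OF C1_real_cutoff])
    moreover have "\<forall>x. x $ i = -1/4 \<or> x $ i = 1/4 \<longrightarrow> G (x $ i) * B (x $ j) = 0"
      using G(1,2) by (metis mult_zero_left)
    ultimately show ?case
      using ij
      by (intro exI conjI) (assumption, auto simp: average_out_prod[OF ij] axis_def algebra_simps)
  next
    case (add f g)
    then obtain w d w' d' where *: "C1_gradient w d" "\<forall>x. d x $ i = f x - average_out i f x"
      "\<forall>x. x $ i = -1/4 \<or> x $ i = 1/4 \<longrightarrow> w x = 0"
      "C1_gradient w' d'" "\<forall>x. d' x $ i = g x - average_out i g x"
      "\<forall>x. x $ i = -1/4 \<or> x $ i = 1/4 \<longrightarrow> w' x = 0"
      by blast
    then have "C1_gradient (\<lambda>x. w x + w' x) (\<lambda>x. d x + d' x)"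
      unfolding C1_gradient_def
      by (auto intro!: continuous_intros has_derivative_eq_rhs[OF has_derivative_add] simp: inner_add_left)
    then show ?case
      using * by (intro exI conjI) (assumption, auto simp: average_out_add[OF add(1,2)])
  qed
  then show ?thesis using that by blast
qed

lemma bump_nonneg: "bump x \<ge> 0"
  by (simp add: bump_def cutoff_nonneg)

lemma bump_le_1: "bump x \<le> 1"
  unfolding bump_def by (intro mult_le_one cutoff_le_1 cutoff_nonneg)

lemma bump_coords:
  assumes "i \<noteq> j"
  shows "bump x = cutoff (x $ i) * cutoff (x $ j)"
proof -
  consider "i = 1" "j = 2" | "i = 2" "j = 1" using assms(1) exhaust_2 by metis
  then show ?thesis by cases (auto simp: bump_def)
qed

lemma bump_eq_0: "\<bar>x $ i\<bar> \<ge> 1/4 \<Longrightarrow> bump x = 0"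
  using exhaust_2[of i] by (auto simp: bump_def cutoff_eq_0)

text \<open>Averaging preserves domination by the bump, which makes it possible to average in the two
  coordinates one after the other.\<close>

lemma average_out_bump:
  assumes "separable \<psi>" and le: "\<And>x. \<bar>\<psi> x\<bar> \<le> bump x"
  shows "\<bar>average_out i \<psi> x\<bar> \<le> bump x"
proof -
  obtain j :: 2 where ij: "i \<noteq> j" by (metis zero_neq_one)
  have "\<bar>\<psi> (with_coord x i t)\<bar> \<le> cutoff t * cutoff (x $ j)" for t
    using le[of "with_coord x i t"] ij by (simp add: bump_coords[OF ij])
  then have "\<bar>integral {-1/4..1/4} (\<lambda>t. \<psi> (with_coord x i t))\<bar> \<le> integral {-1/4..1/4} (\<lambda>t. cutoff t * cutoff (x $ j))"
    by (intro integral_norm_bound_integral[where 'a = real, unfolded real_norm_def] separable_line_integrable assms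
        integrable_on_mult_left cutoff_integrable) auto
  also have "\<dots> = cutoff_mass * cutoff (x $ j)" by (simp add: cutoff_mass_def)
  finally have "\<bar>integral {-1/4..1/4} (\<lambda>t. \<psi> (with_coord x i t))\<bar> / cutoff_mass \<le> cutoff (x $ j)"
    using cutoff_mass_pos by (simp add: divide_le_eq mult.commute)
  from mult_left_mono[OF this cutoff_nonneg[of "x $ i"]] show ?thesis
    using cutoff_mass_pos unfolding average_out_def bump_coords[OF ij]
    by (simp add: abs_mult cutoff_nonneg)
qed

definition square :: "(real^2) set" where
  "square = {x. \<forall>i. \<bar>x $ i\<bar> \<le> 1/4}"

lemma compact_square: "compact square"
proof -
  have "\<bar>t\<bar> \<le> 1/4 \<longleftrightarrow> -1/4 \<le> t \<and> t \<le> 1/4" for t :: real by linarith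
  then have "square = cbox (\<chi> i. -1/4) (\<chi> i. 1/4)"
    unfolding square_def by (simp only: set_eq_iff mem_Collect_eq mem_box_cart vec_lambda_beta simp_thms)
  then show ?thesis by (metis compact_cbox)
qed

lemma square_lebesgue: "square \<in> sets lebesgue"
  using compact_square by (simp add: compact_imp_closed)

text \<open>Integrate the partial derivative from an end of the segment. Inside the square the derivative is
  at most 2 in absolute value and the segment has length \<open>1/2\<close>; outside, the derivative
  vanishes along a whole segment from a suitable end, because the bump does.\<close>

lemma average_out_antiderivative_bound:
  assumes "separable \<psi>" "\<And>x. \<bar>\<psi> x\<bar> \<le> bump x"
    and w: "C1_gradient w d" "\<And>x. d x $ i = \<psi> x - average_out i \<psi> x"
      "\<And>x. x $ i = -1/4 \<Longrightarrow> w x = 0" "\<And>x. x $ i = 1/4 \<Longrightarrow> w x = 0"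
  shows "\<bar>w x\<bar> \<le> indicator square x"
proof -
  have d: "\<bar>d y $ i\<bar> \<le> 2 * bump y" for y
    using assms(2)[of y] average_out_bump[OF assms(1,2), of i y] w(2)[of y] by linarith
  \<comment> \<open>both ends \<open>c\<close> are needed: outside the square only the segment towards one of them may avoid the bump\<close>
  have mvt: "\<bar>w x\<bar> \<le> B * \<bar>x $ i - c\<bar>"
    if c: "c = -1/4 \<or> c = 1/4"
      and B: "\<And>t. t \<in> closed_segment c (x $ i) \<Longrightarrow> \<bar>d (with_coord x i t) $ i\<bar> \<le> B" for c B
  proof -
    have "norm (w (with_coord x i (x $ i)) - w (with_coord x i c)) \<le> B * norm (x $ i - c)"
    proof (rule field_differentiable_bound[where S = "closed_segment c (x $ i)"
          and f = "\<lambda>t. w (with_coord x i t)" and f' = "\<lambda>t. d (with_coord x i t) $ i"])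
      fix t
      have "((\<lambda>t. with_coord x i t) has_derivative (\<lambda>t. t *\<^sub>R axis i 1)) (at t)"
        unfolding with_coord_affine by (auto intro!: derivative_eq_intros)
      from has_derivative_compose[OF this C1_gradient_derivative[OF w(1)]]
      show "((\<lambda>t. w (with_coord x i t)) has_real_derivative d (with_coord x i t) $ i)
          (at t within closed_segment c (x $ i))"
        by (rule has_field_derivative_at_within[OF has_derivative_imp_has_field_derivative])
           (simp add: inner_axis)
    qed (use B in auto)
    moreover have "w (with_coord x i c) = 0" using c w(3,4)[of "with_coord x i c"] by auto
    ultimately show ?thesis by simp
  qed
  have outside: "w x = 0" if c: "c = -1/4 \<or> c = 1/4"
    and 0: "\<And>t. t \<in> closed_segment c (x $ i) \<Longrightarrow> bump (with_coord x i t) = 0" for c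
  proof -
    have "\<bar>w x\<bar> \<le> 0 * \<bar>x $ i - c\<bar>"
    proof (rule mvt[OF c])
      fix t assume "t \<in> closed_segment c (x $ i)"
      then show "\<bar>d (with_coord x i t) $ i\<bar> \<le> 0" using d[of "with_coord x i t"] 0 by simp
    qed
    then show ?thesis by simp
  qed
  show ?thesis
  proof (cases "x \<in> square")
    case True
    then have "\<bar>x $ i\<bar> \<le> 1/4" by (simp only: square_def mem_Collect_eq)
    then have xi: "\<bar>x $ i - (-1/4)\<bar> \<le> 1/2" by linarith
    have "\<bar>d y $ i\<bar> \<le> 2" for y using d[of y] bump_le_1[of y] by linarith
    then have "\<bar>w x\<bar> \<le> 2 * \<bar>x $ i - (-1/4)\<bar>" by (intro mvt) auto
    then show ?thesis using xi True by simp
  next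
    case False
    then obtain k where k: "\<bar>x $ k\<bar> > 1/4" by (auto simp: square_def not_le)
    consider "x $ i > 1/4" | "x $ i < -1/4" | "k \<noteq> i"
      using k by (cases "k = i") (auto simp: abs_if split: if_splits)
    then have "w x = 0"
    proof cases
      case 1
      show ?thesis
        by (rule outside[of "1/4"], simp)
           (rule bump_eq_0[of _ i], use 1 in \<open>auto simp: closed_segment_eq_real_ivl\<close>)
    next
      case 2
      show ?thesis
        by (rule outside[of "-1/4"], simp)
           (rule bump_eq_0[of _ i], use 2 in \<open>auto simp: closed_segment_eq_real_ivl\<close>)
    next
      case 3
      show ?thesis
        by (rule outside[of "1/4"], simp) (rule bump_eq_0[of _ k], use 3 k in auto)
    qed
    then show ?thesis by simp
  qed
qed

lemma separable_bump_bound_integrable: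
  assumes "integrable lebesgue f" "separable \<psi>" "\<And>x. \<bar>\<psi> x\<bar> \<le> bump x"
  shows "integrable lebesgue (\<lambda>x. f x * \<psi> x)"
proof (rule Bochner_Integration.integrable_bound[OF assms(1)])
  show "(\<lambda>x. f x * \<psi> x) \<in> borel_measurable lebesgue"
    using assms(1) continuous_lebesgue_measurable[OF separable_continuous[OF assms(2)]]
    by (intro borel_measurable_times) auto
  show "AE x in lebesgue. norm (f x * \<psi> x) \<le> norm (f x)"
    using order_trans[OF assms(3) bump_le_1]
    by (intro AE_I2) (simp add: abs_mult mult_left_le)
qed

text \<open>Integration by parts against the bounded antiderivative, which lives on the square.\<close>

lemma integral_average_out_diff:
  assumes f: "integrable lebesgue f" "is_weak_gradient f g"
    and \<psi>: "separable \<psi>" "\<And>x. \<bar>\<psi> x\<bar> \<le> bump x"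
  shows "\<bar>(LINT x|lebesgue. f x * \<psi> x) - (LINT x|lebesgue. f x * average_out i \<psi> x)\<bar>
    \<le> (LINT x|lebesgue. indicator square x * norm (g x))"
proof -
  obtain w d where w: "C1_gradient w d" "\<And>x. d x $ i = \<psi> x - average_out i \<psi> x"
    "\<And>x. x $ i = -1/4 \<Longrightarrow> w x = 0" "\<And>x. x $ i = 1/4 \<Longrightarrow> w x = 0"
    using average_out_antiderivative[OF \<psi>(1)] by blast
  have wb: "\<bar>w x\<bar> \<le> indicator square x" for x
    by (rule average_out_antiderivative_bound[OF \<psi> w])
  have w0: "w x = 0" if "x \<notin> square" for x using wb[of x] that by simp
  have bnd: "bounded {x. w x \<noteq> 0}"
    by (rule bounded_subset[OF compact_imp_bounded[OF compact_square]]) (use w0 in auto)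
  have ig: "integrable lebesgue g" by (rule is_weak_gradient_integrable[OF f(2)])
  have "(LINT x|lebesgue. f x * \<psi> x) - (LINT x|lebesgue. f x * average_out i \<psi> x)
      = (LINT x|lebesgue. f x * d x $ i)"
    using separable_bump_bound_integrable[OF f(1) \<psi>]
      separable_bump_bound_integrable[OF f(1) separable_average_out[OF \<psi>(1)] average_out_bump[OF \<psi>]]
    by (simp add: w(2) right_diff_distrib)
  also have "\<dots> = - (LINT x|lebesgue. g x $ i * w x)"
    by (rule weak_gradient_integral_by_parts[OF f(2) w(1) bnd])
  also have "\<bar>\<dots>\<bar> \<le> (LINT x|lebesgue. \<bar>g x $ i * w x\<bar>)"
    by (simp add: integral_abs_bound)
  also have "\<dots> \<le> (LINT x|lebesgue. indicator square x * norm (g x))"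
  proof (rule integral_mono')
    show "integrable lebesgue (\<lambda>x. indicator square x * norm (g x))"
      using integrable_mult_indicator[OF square_lebesgue integrable_norm[OF ig]] by simp
    show "\<bar>g x $ i * w x\<bar> \<le> indicator square x * norm (g x)" for x
      using mult_mono[OF component_le_norm_cart[of "g x" i] wb[of x]] by (simp add: abs_mult mult.commute)
  qed simp
  finally show ?thesis .
qed

lemma average_out_twice:
  obtains c where "\<And>x. average_out 2 (average_out 1 \<psi>) x = c * bump x"
proof -
  let ?I = "\<lambda>x t. integral {-1/4..1/4} (\<lambda>s. \<psi> (with_coord (with_coord x 2 t) 1 s))"
  have coords: "with_coord (with_coord x 2 t) 1 s = with_coord (with_coord 0 2 t) 1 s" for x t s
    by (simp add: vec_eq_iff forall_2)
  have I: "?I x t = ?I 0 t" for x t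
    by (rule arg_cong[where f = "integral {-1/4..1/4}"], rule ext, rule arg_cong[OF coords])
  have "average_out 2 (average_out 1 \<psi>) x
      = integral {-1/4..1/4} (\<lambda>t. ?I 0 t / cutoff_mass) / cutoff_mass * bump x" for x
  proof -
    have "average_out 2 (average_out 1 \<psi>) x
        = cutoff (x $ 2) * (integral {-1/4..1/4} (\<lambda>t. cutoff (x $ 1) * (?I x t / cutoff_mass)) / cutoff_mass)"
      by (simp add: average_out_def)
    then show ?thesis unfolding I[of x] integral_mult_right by (simp add: bump_def)
  qed
  then show ?thesis using that by blast
qed

text \<open>Averaging in both coordinates costs the gradient mass on the square twice and turns \<open>\<psi>\<close> into
  a multiple \<open>c\<close> of the bump; evaluation at the origin, where the bump is one, gives
  \<open>\<bar>c\<bar> \<le> 1\<close>.\<close>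

lemma integral_separable_le:
  assumes f: "integrable lebesgue f" "is_weak_gradient f g"
    and \<psi>: "separable \<psi>" "\<And>x. \<bar>\<psi> x\<bar> \<le> bump x"
  shows "\<bar>LINT x|lebesgue. f x * \<psi> x\<bar>
    \<le> \<bar>LINT x|lebesgue. f x * bump x\<bar> + 2 * (LINT x|lebesgue. indicator square x * norm (g x))"
proof -
  let ?\<psi>1 = "average_out 1 \<psi>" and ?\<psi>2 = "average_out 2 (average_out 1 \<psi>)"
  note \<psi>1 = separable_average_out[OF \<psi>(1), of 1] average_out_bump[OF \<psi>, of 1]
  obtain c where c: "\<And>x. ?\<psi>2 x = c * bump x" using average_out_twice by blast
  have "\<bar>c\<bar> \<le> 1"
    using average_out_bump[OF \<psi>1, of 2 0] by (simp add: c bump_def cutoff_def)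
  have "(LINT x|lebesgue. f x * ?\<psi>2 x) = c * (LINT x|lebesgue. f x * bump x)"
    unfolding c by (simp add: mult.left_commute)
  then have "\<bar>LINT x|lebesgue. f x * ?\<psi>2 x\<bar> \<le> \<bar>LINT x|lebesgue. f x * bump x\<bar>"
    using mult_right_mono[OF \<open>\<bar>c\<bar> \<le> 1\<close>] by (simp add: abs_mult)
  then show ?thesis
    using integral_average_out_diff[OF f \<psi>, of 1] integral_average_out_diff[OF f \<psi>1, of 2] by linarith
qed

text \<open>A measurable function is an almost everywhere limit of continuous functions. These are clamped
  to \<open>{-1..1}\<close>, approximated by polynomials up to \<open>1 / Suc n\<close> on \<open>K\<close>, and rescaled so that the bound
  by one survives the approximation.\<close>

lemma sgn_polynomial_approximation:
  fixes f :: "real^2 \<Rightarrow> real"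
  assumes "f \<in> borel_measurable lebesgue" "compact K"
  obtains q :: "nat \<Rightarrow> real^2 \<Rightarrow> real"
    where "\<And>n. real_polynomial_function (q n)" "\<And>n x. x \<in> K \<Longrightarrow> \<bar>q n x\<bar> \<le> 1"
      "AE x in lebesgue. x \<in> K \<longrightarrow> (\<lambda>n. q n x) \<longlonglongrightarrow> sgn (f x)"
proof -
  have "(\<lambda>x. sgn (f x)) \<in> borel_measurable lebesgue"
    using assms(1) by measurable
  then have "(\<lambda>x. sgn (f x)) measurable_on UNIV"
    by (simp add: measurable_on_iff_borel_measurable)
  then obtain N h where N: "negligible N" and h: "\<And>n::nat. continuous_on UNIV (h n)"
    "\<And>x. x \<notin> N \<Longrightarrow> (\<lambda>n. h n x) \<longlonglongrightarrow> sgn (f x)"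
    unfolding measurable_on_def by auto
  define k where "k n x = max (-1) (min 1 (h n x))" for n x
  have kc: "continuous_on K (k n)" for n
    unfolding k_def by (intro continuous_intros continuous_on_subset[OF h(1)]) auto
  have "\<exists>p. real_polynomial_function p \<and> (\<forall>x\<in>K. \<bar>k n x - p x\<bar> < 1 / real (Suc n))" for n
    by (rule Stone_Weierstrass_real_polynomial_function[OF assms(2) kc[of n], of "1 / real (Suc n)"]) auto
  then obtain p where p: "\<And>n. real_polynomial_function (p n)"
    "\<And>n x. x \<in> K \<Longrightarrow> \<bar>k n x - p n x\<bar> < 1 / real (Suc n)"
    by metis
  define q where "q n x = (1 / (1 + 1 / real (Suc n))) * p n x" for n x
  show ?thesis
  proof
    show "real_polynomial_function (q n)" for n
      unfolding q_def[abs_def] by (intro real_polynomial_function.intros(2,4) p)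
    show "\<bar>q n x\<bar> \<le> 1" if "x \<in> K" for n x
    proof -
      have "\<bar>k n x\<bar> \<le> 1" by (auto simp: k_def)
      then have "\<bar>p n x\<bar> \<le> 1 + 1 / real (Suc n)" using p(2)[OF that, of n] by linarith
      then show ?thesis unfolding q_def abs_mult
        by (simp add: divide_le_eq add_pos_pos)
    qed
    have "(\<lambda>n. q n x) \<longlonglongrightarrow> sgn (f x)" if "x \<notin> N" "x \<in> K" for x
    proof -
      have "(\<lambda>n. k n x) \<longlonglongrightarrow> max (-1) (min 1 (sgn (f x)))"
        unfolding k_def by (intro tendsto_intros h that)
      then have "(\<lambda>n. k n x) \<longlonglongrightarrow> sgn (f x)" by (simp add: sgn_real_def split: if_splits)
      moreover have e: "(\<lambda>n. 1 / real (Suc n)) \<longlonglongrightarrow> 0"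
        using LIMSEQ_inverse_real_of_nat by (simp add: inverse_eq_divide)
      have "(\<lambda>n. k n x - p n x) \<longlonglongrightarrow> 0"
        by (rule Lim_null_comparison[OF _ e]) (use p(2)[OF that(2)] in \<open>auto intro!: always_eventually less_imp_le\<close>)
      ultimately have "(\<lambda>n. k n x - (k n x - p n x)) \<longlonglongrightarrow> sgn (f x) - 0"
        by (intro tendsto_diff)
      then have "(\<lambda>n. p n x) \<longlonglongrightarrow> sgn (f x)" by simp
      moreover have "(\<lambda>n. 1 / (1 + 1 / real (Suc n))) \<longlonglongrightarrow> 1 / (1 + 0)"
        by (intro tendsto_intros e) auto
      ultimately show ?thesis
        unfolding q_def using tendsto_mult by fastforce
    qed
    moreover have "AE x in lebesgue. x \<notin> N"
      using N by (auto simp: negligible_iff_null_sets intro: AE_not_in)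
    ultimately show "AE x in lebesgue. x \<in> K \<longrightarrow> (\<lambda>n. q n x) \<longlonglongrightarrow> sgn (f x)"
      by (auto elim: eventually_mono)
  qed
qed

text \<open>Test with \<open>\<psi> n = bump * q n\<close>, where the polynomials \<open>q n\<close> tend to the sign of \<open>f\<close>: the bounds for
  separable functions pass to the limit.\<close>

lemma weighted_poincare:
  assumes f: "integrable lebesgue f" "is_weak_gradient f g"
  shows "(LINT x|lebesgue. \<bar>f x\<bar> * bump x)
    \<le> \<bar>LINT x|lebesgue. f x * bump x\<bar> + 2 * (LINT x|lebesgue. indicator square x * norm (g x))"
proof -
  have fm: "f \<in> borel_measurable lebesgue" using f(1) by auto
  obtain q where q: "\<And>n. real_polynomial_function (q n)" "\<And>n x. x \<in> square \<Longrightarrow> \<bar>q n x\<bar> \<le> 1"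
    "AE x in lebesgue. x \<in> square \<longrightarrow> (\<lambda>n. q n x) \<longlonglongrightarrow> sgn (f x)"
    using sgn_polynomial_approximation[OF fm compact_square] by blast
  define \<psi> where "\<psi> n x = bump x * q n x" for n x
  have out: "bump x = 0" if "x \<notin> square" for x
    using that bump_eq_0[of x] by (auto simp: square_def not_le) (meson less_imp_le)
  have sep: "separable (\<psi> n)" for n
    unfolding \<psi>_def[abs_def] by (intro separable_mult separable_bump separable_real_polynomial_function q)
  have le: "\<bar>\<psi> n x\<bar> \<le> bump x" for n x
    using out[of x] q(2)[of x n] bump_nonneg[of x]
    by (cases "x \<in> square") (auto simp: \<psi>_def abs_mult mult_left_le)
  have "(\<lambda>n. LINT x|lebesgue. f x * \<psi> n x) \<longlonglongrightarrow> (LINT x|lebesgue. \<bar>f x\<bar> * bump x)"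
  proof (rule integral_dominated_convergence[where w = "\<lambda>x. norm (f x)"])
    show "integrable lebesgue (\<lambda>x. norm (f x))" using f(1) by auto
    show "(\<lambda>x. f x * \<psi> n x) \<in> borel_measurable lebesgue" for n
      using separable_bump_bound_integrable[OF f(1) sep le] by auto
    show "(\<lambda>x. \<bar>f x\<bar> * bump x) \<in> borel_measurable lebesgue"
      using fm continuous_lebesgue_measurable[OF separable_continuous[OF separable_bump]]
      by (intro borel_measurable_times borel_measurable_abs)
    show "AE x in lebesgue. norm (f x * \<psi> n x) \<le> norm (f x)" for n
      using order_trans[OF le bump_le_1] by (intro AE_I2) (simp add: abs_mult mult_left_le)
    show "AE x in lebesgue. (\<lambda>n. f x * \<psi> n x) \<longlonglongrightarrow> \<bar>f x\<bar> * bump x"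
      using q(3)
    proof eventually_elim
      case (elim x)
      show ?case
      proof (cases "x \<in> square")
        case True
        then have "(\<lambda>n. f x * (bump x * q n x)) \<longlonglongrightarrow> f x * (bump x * sgn (f x))"
          using elim by (intro tendsto_intros) auto
        moreover have "f x * (bump x * sgn (f x)) = \<bar>f x\<bar> * bump x"
          by (simp add: abs_sgn)
        ultimately show ?thesis by (simp add: \<psi>_def)
      qed (simp add: \<psi>_def out)
    qed
  qed
  moreover have "(LINT x|lebesgue. f x * \<psi> n x)
      \<le> \<bar>LINT x|lebesgue. f x * bump x\<bar> + 2 * (LINT x|lebesgue. indicator square x * norm (g x))" for n
    using integral_separable_le[OF f sep[of n] le] by linarith
  ultimately show ?thesis by (blast intro: LIMSEQ_le_const2)
qed

section \<open>The calibration\<close>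

lemma integrable_mult_bounded:
  fixes f k :: "real^2 \<Rightarrow> real"
  assumes "integrable lebesgue f" "k \<in> borel_measurable lebesgue" "\<And>x. \<bar>k x\<bar> \<le> C"
  shows "integrable lebesgue (\<lambda>x. f x * k x)"
proof (rule Bochner_Integration.integrable_bound)
  show "integrable lebesgue (\<lambda>x. C * f x)" using assms by auto
  show "(\<lambda>x. f x * k x) \<in> borel_measurable lebesgue"
    using assms by (intro borel_measurable_times) auto
  show "AE x in lebesgue. norm (f x * k x) \<le> norm (C * f x)"
  proof (rule AE_I2)
    fix x
    have "\<bar>f x\<bar> * \<bar>k x\<bar> \<le> \<bar>f x\<bar> * \<bar>C\<bar>" using assms(3)[of x] by (intro mult_left_mono) auto
    then show "norm (f x * k x) \<le> norm (C * f x)" by (simp add: abs_mult mult.commute)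
  qed
qed

text \<open>The factor multiplying \<open>f\<close> is the divergence of the radial field \<open>P (x \<bullet> x) *\<^sub>R x\<close> in dimension two.\<close>

lemma radial_integral_by_parts:
  assumes f: "integrable lebesgue f" "is_weak_gradient f g"
    and P: "\<And>t. t \<ge> 0 \<Longrightarrow> (P has_real_derivative P' t) (at t)" "continuous_on {0..} P'"
      "\<And>t. t \<ge> R \<Longrightarrow> P t = 0"
  shows "(LINT x|lebesgue. f x * (2 * P (x \<bullet> x) + 2 * (x \<bullet> x) * P' (x \<bullet> x)))
    = - (LINT x|lebesgue. P (x \<bullet> x) * (g x \<bullet> x))"
proof -
  define d where "d i x = x $ i *\<^sub>R (2 * P' (x \<bullet> x)) *\<^sub>R x + P (x \<bullet> x) *\<^sub>R axis i 1"
    for i and x :: "real^2"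
  have d: "C1_gradient (\<lambda>x. x $ i * P (x \<bullet> x)) (d i)" for i
    using C1_gradient_mult[OF C1_gradient_coord[of "\<lambda>t. t" "\<lambda>t. 1" i] C1_gradient_sum_squares[OF P(1,2)]]
    by (simp add: d_def[abs_def])
  have bnd: "bounded {x. x $ i * P (x \<bullet> x) \<noteq> 0}" for i :: 2
  proof (rule boundedI)
    fix x assume "x \<in> {x. x $ i * P (x \<bullet> x) \<noteq> 0}"
    then have "x \<bullet> x < R" using P(3)[of "x \<bullet> x"] by (auto simp: not_le[symmetric])
    then show "norm x \<le> sqrt R" by (simp add: norm_eq_sqrt_inner)
  qed
  have parts: "(LINT x|lebesgue. f x * d i x $ i) = - (LINT x|lebesgue. g x $ i * (x $ i * P (x \<bullet> x)))" for i
    by (rule weak_gradient_integral_by_parts[OF f(2) d bnd])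
  have int_d: "integrable lebesgue (\<lambda>x. f x * d i x $ i)" for i
  proof -
    obtain C where "\<And>x. norm (d i x) \<le> C" using C1_gradient_bounds[OF d bnd] by metis
    then have "\<bar>d i x $ i\<bar> \<le> C" for x using component_le_norm_cart order_trans by blast
    then show ?thesis
      by (intro integrable_mult_bounded[OF f(1)] continuous_lebesgue_measurable
          continuous_intros C1_gradient_continuous[OF d])
  qed
  have int_g: "integrable lebesgue (\<lambda>x. g x $ i * (x $ i * P (x \<bullet> x)))" for i
  proof -
    obtain C r where r: "\<And>x. norm x > r \<Longrightarrow> x $ i * P (x \<bullet> x) = 0"
      using C1_gradient_bounds[OF d bnd] by metis
    have "x $ i * P (x \<bullet> x) = 0" if "x \<notin> cball 0 r" for x using r[of x] that by (simp add: not_le)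
    then obtain C where "\<And>x. norm (x $ i * P (x \<bullet> x)) \<le> C"
      using bounded_of_compact_support[OF C1_gradient_continuous(1)[OF d] compact_cball[of 0 r]] by blast
    then show ?thesis
      using is_weak_gradient_integrable[OF f(2)]
      by (intro integrable_mult_bounded integrable_bounded_linear[OF bounded_linear_vec_nth]
          continuous_lebesgue_measurable C1_gradient_continuous(1)[OF d]) auto
  qed
  have "(\<Sum>i\<in>UNIV. LINT x|lebesgue. f x * d i x $ i)
      = (LINT x|lebesgue. (\<Sum>i\<in>UNIV. f x * d i x $ i))"
    using int_d by (intro Bochner_Integration.integral_sum[symmetric]) auto
  also have "(\<lambda>x. \<Sum>i\<in>UNIV. f x * d i x $ i)
      = (\<lambda>x. f x * (2 * P (x \<bullet> x) + 2 * (x \<bullet> x) * P' (x \<bullet> x)))"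
    by (simp add: d_def axis_def sum_2 inner_vec_def algebra_simps)
  finally have 1: "(LINT x|lebesgue. f x * (2 * P (x \<bullet> x) + 2 * (x \<bullet> x) * P' (x \<bullet> x)))
      = (\<Sum>i\<in>UNIV. LINT x|lebesgue. f x * d i x $ i)" ..
  have "(\<Sum>i\<in>UNIV. LINT x|lebesgue. g x $ i * (x $ i * P (x \<bullet> x)))
      = (LINT x|lebesgue. (\<Sum>i\<in>UNIV. g x $ i * (x $ i * P (x \<bullet> x))))"
    using int_g by (intro Bochner_Integration.integral_sum[symmetric]) auto
  also have "(\<lambda>x. \<Sum>i\<in>UNIV. g x $ i * (x $ i * P (x \<bullet> x))) = (\<lambda>x. P (x \<bullet> x) * (g x \<bullet> x))"
    by (simp add: sum_2 inner_vec_def algebra_simps)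
  finally show ?thesis unfolding 1 parts by (simp add: sum_negf)
qed

text \<open>Chosen such that \<open>r * profile (r\<^sup>2)\<close>, the length of the field \<open>calibration\<close> at distance \<open>r\<close> from the
  origin, has the unique maximum 1 at \<open>r = 1\<close>, with compact support and a continuous derivative.\<close>

definition profile :: "real \<Rightarrow> real" where
  "profile s = (max 0 (5 - s))\<^sup>2 / 16"

definition calibration :: "real^2 \<Rightarrow> real^2" where
  "calibration x = - profile (x \<bullet> x) *\<^sub>R x"

text \<open>The second summand is minus the divergence of \<open>calibration\<close>, so that integrating \<open>f\<close> against this
  kernel amounts to integrating \<open>f\<close> over the unit disc and adding the integral of
  \<open>\<nabla>f \<bullet> calibration\<close>.\<close>

definition calibration_kernel :: "real^2 \<Rightarrow> real" where
  "calibration_kernel x = indicator (cball 0 1) x + max 0 (5 - x \<bullet> x) * (5 - 3 * (x \<bullet> x)) / 8"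

lemma profile_derivative: "(profile has_real_derivative - (max 0 (5 - s)) / 8) (at s)"
proof -
  have "((\<lambda>s. 5 - s) has_real_derivative -1) (at s)" by (auto intro!: derivative_eq_intros)
  from DERIV_chain2[OF has_real_derivative_pos_part_sq this, THEN DERIV_cdivide[of _ _ _ _ 16]]
  show ?thesis by (simp add: profile_def[abs_def])
qed

lemma profile_nonneg: "profile s \<ge> 0"
  by (simp add: profile_def)

lemma profile_ge_1: "s \<le> 1 \<Longrightarrow> profile s \<ge> 1"
  using power_mono[of 4 "max 0 (5 - s)" 2] by (simp add: profile_def)

lemma profile_le: "s \<ge> 0 \<Longrightarrow> profile s \<le> 25/16"
  using power_mono[of "max 0 (5 - s)" 5 2] by (simp add: profile_def)

lemma norm_calibration: "norm (calibration x) = profile (x \<bullet> x) * norm x"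
  by (simp add: calibration_def profile_nonneg)

lemma norm_calibration_le_1: "norm (calibration x) \<le> 1"
proof (cases "x \<bullet> x \<le> 5")
  case True
  define t where "t = norm x"
  have t: "t \<ge> 0" "t\<^sup>2 \<le> 5" "x \<bullet> x = t\<^sup>2"
    using True by (auto simp: t_def dot_square_norm)
  \<comment> \<open>\<open>16 - t * (5 - t\<^sup>2)\<^sup>2\<close> has a double zero at \<open>t = 1\<close>; the cofactor is nonnegative on the support\<close>
  have "t * t\<^sup>2 \<le> t * 5" using t by (intro mult_left_mono)
  then have "0 \<le> (1 - t)\<^sup>2 * (16 + 7 * t - 2 * t\<^sup>2 - t * t\<^sup>2)"
    using t by (intro mult_nonneg_nonneg) auto
  also have "\<dots> = 16 - t * (5 - t\<^sup>2)\<^sup>2"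
    by (simp add: power2_eq_square algebra_simps)
  finally show ?thesis
    using t(2) by (simp add: norm_calibration profile_def t(3) flip: t_def) (simp add: mult.commute)
qed (simp add: norm_calibration profile_def)

lemma norm_calibration_square:
  assumes "x \<in> square"
  shows "norm (calibration x) \<le> 3/4"
proof -
  have "\<bar>x $ i\<bar> \<le> 1/4" for i using assms by (simp only: square_def mem_Collect_eq)
  then have "\<bar>x $ i\<bar>\<^sup>2 \<le> (1/4)\<^sup>2" for i by (intro power_mono) auto
  then have i: "(x $ i)\<^sup>2 \<le> 1/16" for i by (simp add: power_divide)
  have "(norm x)\<^sup>2 = (x $ 1)\<^sup>2 + (x $ 2)\<^sup>2"
    unfolding power2_norm_eq_inner by (simp add: inner_vec_def sum_2 power2_eq_square)
  then have "(norm x)\<^sup>2 \<le> 1/8" using i[of 1] i[of 2] by linarith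
  then have "(norm x)\<^sup>2 \<le> (12/25)\<^sup>2" by (rule order_trans) (simp add: power2_eq_square)
  then have "norm x \<le> 12/25" by (rule power2_le_imp_le) simp
  then have "profile (x \<bullet> x) * norm x \<le> 25/16 * (12/25)"
    by (intro mult_mono profile_le) auto
  then show ?thesis by (simp add: norm_calibration)
qed

lemma calibration_kernel_measurable: "calibration_kernel \<in> borel_measurable lebesgue"
  unfolding calibration_kernel_def[abs_def]
  by (intro borel_measurable_add borel_measurable_indicator continuous_lebesgue_measurable continuous_intros) auto

lemma calibration_kernel_bound: "\<bar>calibration_kernel x\<bar> \<le> 5"
proof -
  define s where "s = x \<bullet> x"
  have "s \<ge> 0" by (simp add: s_def)
  have "\<bar>max 0 (5 - s) * (5 - 3 * s) / 8\<bar> \<le> 4"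
  proof (cases "s \<le> 5")
    case True
    have "(5 - s) * (5 - 3 * s) = 3 * (s - 10/3)\<^sup>2 - 25/3"
      by (simp add: power2_eq_square algebra_simps)
    moreover have "(5 - s) * (5 - 3 * s) = 25 - s * (20 - 3 * s)" by (simp add: algebra_simps)
    moreover have "s * (20 - 3 * s) \<ge> 0" using True \<open>s \<ge> 0\<close> by simp
    ultimately have "\<bar>(5 - s) * (5 - 3 * s)\<bar> \<le> 32"
      using zero_le_power2[of "s - 10/3"] by linarith
    then show ?thesis using True by simp
  qed simp
  then show ?thesis unfolding calibration_kernel_def s_def[symmetric] by (auto simp: indicator_def)
qed

lemma integral_calibration_kernel:
  assumes f: "integrable lebesgue f" "is_weak_gradient f g"
  shows "integrable lebesgue (\<lambda>x. indicator (cball 0 1) x * f x)"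
    "integrable lebesgue (\<lambda>x. g x \<bullet> calibration x)"
    "(LINT x|lebesgue. f x * calibration_kernel x)
      = (LINT x|lebesgue. indicator (cball 0 1) x * f x) + (LINT x|lebesgue. g x \<bullet> calibration x)"
proof -
  show B: "integrable lebesgue (\<lambda>x. indicator (cball 0 1) x * f x)"
    using integrable_mult_indicator[OF _ f(1), of "cball 0 1"] by simp
  have g: "integrable lebesgue g" by (rule is_weak_gradient_integrable[OF f(2)])
  have cal: "continuous_on UNIV calibration"
    unfolding calibration_def[abs_def] profile_def by (intro continuous_intros) auto
  show "integrable lebesgue (\<lambda>x. g x \<bullet> calibration x)"
  proof (rule Bochner_Integration.integrable_bound[OF g])
    show "(\<lambda>x. g x \<bullet> calibration x) \<in> borel_measurable lebesgue"
      using g continuous_lebesgue_measurable[OF cal] by (intro borel_measurable_inner) auto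
    show "AE x in lebesgue. norm (g x \<bullet> calibration x) \<le> norm (g x)"
      using order_trans[OF Cauchy_Schwarz_ineq2 mult_left_le[OF norm_calibration_le_1 norm_ge_zero]]
      by (intro AE_I2) simp
  qed
  define h where "h x = 2 * profile (x \<bullet> x) + 2 * (x \<bullet> x) * (- (max 0 (5 - x \<bullet> x)) / 8)" for x :: "real^2"
  have h: "calibration_kernel x = indicator (cball 0 1) x + h x" for x
    by (simp add: calibration_kernel_def h_def profile_def max_def power2_eq_square algebra_simps divide_simps)
  have "(LINT x|lebesgue. f x * h x) = - (LINT x|lebesgue. profile (x \<bullet> x) * (g x \<bullet> x))"
    unfolding h_def
    by (rule radial_integral_by_parts[OF f profile_derivative, where R = 5])
       (auto intro!: continuous_intros simp: profile_def)
  then have parts: "(LINT x|lebesgue. f x * h x) = (LINT x|lebesgue. g x \<bullet> calibration x)"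
    by (simp add: calibration_def)
  have "integrable lebesgue (\<lambda>x. f x * calibration_kernel x - indicator (cball 0 1) x * f x)"
    by (intro Bochner_Integration.integrable_diff B
        integrable_mult_bounded[OF f(1) calibration_kernel_measurable calibration_kernel_bound])
  then have "integrable lebesgue (\<lambda>x. f x * h x)" by (simp add: h algebra_simps)
  then show "(LINT x|lebesgue. f x * calibration_kernel x)
      = (LINT x|lebesgue. indicator (cball 0 1) x * f x) + (LINT x|lebesgue. g x \<bullet> calibration x)"
    using B by (simp add: h distrib_left mult.commute[of "f _" "indicator _ _"] flip: parts)
qed

text \<open>The defect of \<open>f\<close> in the inequality between the functional and the norm splits into two nonnegative
  parts, so both are small for near maximisers. The first measures the negative part of \<open>f\<close> and its
  mass outside the disc, the second measures where the gradient fails to be aligned with a unit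
  calibration.\<close>

lemma calibration_deficit:
  assumes f: "integrable lebesgue f" "is_weak_gradient f g"
  shows "integrable lebesgue (\<lambda>x. \<bar>f x\<bar> - indicator (cball 0 1) x * f x)"
    "integrable lebesgue (\<lambda>x. norm (g x) - g x \<bullet> calibration x)"
    "(LINT x|lebesgue. \<bar>f x\<bar> - indicator (cball 0 1) x * f x)
       + (LINT x|lebesgue. norm (g x) - g x \<bullet> calibration x)
     = sobolev_norm f - (LINT x|lebesgue. f x * calibration_kernel x)"
    "\<And>x. 0 \<le> \<bar>f x\<bar> - indicator (cball 0 1) x * f x"
    "\<And>x. 0 \<le> norm (g x) - g x \<bullet> calibration x"
proof -
  note k = integral_calibration_kernel[OF f]
  have g: "integrable lebesgue g" by (rule is_weak_gradient_integrable[OF f(2)])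
  show "integrable lebesgue (\<lambda>x. \<bar>f x\<bar> - indicator (cball 0 1) x * f x)"
    "integrable lebesgue (\<lambda>x. norm (g x) - g x \<bullet> calibration x)"
    using k f g by auto
  show "(LINT x|lebesgue. \<bar>f x\<bar> - indicator (cball 0 1) x * f x)
       + (LINT x|lebesgue. norm (g x) - g x \<bullet> calibration x)
     = sobolev_norm f - (LINT x|lebesgue. f x * calibration_kernel x)"
    unfolding k(3) sobolev_norm_eq[OF f(2)] using k f g by simp
  show "0 \<le> \<bar>f x\<bar> - indicator (cball 0 1) x * f x" for x
    by (auto simp: indicator_def)
  show "0 \<le> norm (g x) - g x \<bullet> calibration x" for x
    using order_trans[OF norm_cauchy_schwarz mult_left_le[OF norm_calibration_le_1 norm_ge_zero], of "g x" x]
    by simp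
qed

lemma deficits_of_near_maximizer:
  assumes f: "integrable lebesgue f" "is_weak_gradient f g"
    and "sobolev_norm f \<le> 1" "(LINT x|lebesgue. f x * calibration_kernel x) > 1 - \<epsilon>"
  shows "(LINT x|lebesgue. \<bar>f x\<bar> - indicator (cball 0 1) x * f x) \<le> \<epsilon>"
    "(LINT x|lebesgue. norm (g x) - g x \<bullet> calibration x) \<le> \<epsilon>"
proof -
  note k = calibration_deficit[OF f]
  have "(LINT x|lebesgue. \<bar>f x\<bar> - indicator (cball 0 1) x * f x) \<ge> 0"
    "(LINT x|lebesgue. norm (g x) - g x \<bullet> calibration x) \<ge> 0"
    using k(4,5) by (auto intro: integral_nonneg)
  then show "(LINT x|lebesgue. \<bar>f x\<bar> - indicator (cball 0 1) x * f x) \<le> \<epsilon>"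
    "(LINT x|lebesgue. norm (g x) - g x \<bullet> calibration x) \<le> \<epsilon>"
    using k(3) assms(3,4) by linarith+
qed

text \<open>On the square the calibration has length at most \<open>3/4\<close>, so a quarter of the gradient there counts
  as deficit.\<close>

lemma gradient_square_le_deficit:
  assumes f: "integrable lebesgue f" "is_weak_gradient f g"
  shows "(LINT x|lebesgue. indicator square x * norm (g x))
    \<le> 4 * (LINT x|lebesgue. norm (g x) - g x \<bullet> calibration x)"
proof -
  note k = calibration_deficit[OF f]
  have "(LINT x|lebesgue. indicator square x * norm (g x))
      \<le> (LINT x|lebesgue. 4 * (norm (g x) - g x \<bullet> calibration x))"
  proof (rule integral_mono')
    show "integrable lebesgue (\<lambda>x. 4 * (norm (g x) - g x \<bullet> calibration x))" by (intro integrable_mult_right k(2))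
    show "indicator square x * norm (g x) \<le> 4 * (norm (g x) - g x \<bullet> calibration x)" for x
    proof (cases "x \<in> square")
      case True
      have "g x \<bullet> calibration x \<le> norm (g x) * (3/4)"
        using order_trans[OF norm_cauchy_schwarz mult_left_mono[OF norm_calibration_square[OF True] norm_ge_zero]] .
      then show ?thesis using True by simp
    qed (use k(5)[of x] in simp)
  qed (use k(5) in simp)
  then show ?thesis by (simp only: integral_mult_right_zero)
qed

section \<open>The functional has norm one\<close>

text \<open>A smoothed step \<open>a / (a + b)\<close>: the numerator \<open>a\<close> decreases to zero at 1, and \<open>b\<close> starts to
  increase at \<open>1 - \<tau>\<close>, so the denominator never vanishes.\<close>

lemma radial_step:
  fixes \<tau> :: real
  assumes "0 < \<tau>" "\<tau> < 1"
  obtains p p' :: "real \<Rightarrow> real"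
    where "\<And>s. (p has_real_derivative p' s) (at s)" "continuous_on UNIV p'" "\<And>s. p s \<ge> 0"
      "\<And>s. s \<ge> 1 \<Longrightarrow> p s = 0" "p 0 = 1" "\<And>s. p' s \<le> 0"
      "\<And>s. s < 1 - \<tau> \<or> s > 1 \<Longrightarrow> p' s = 0"
proof -
  define a where "a s = (max 0 (1 - s))\<^sup>2" for s :: real
  define b where "b s = (max 0 (s - (1 - \<tau>)))\<^sup>2" for s :: real
  define a' where "a' s = - 2 * max 0 (1 - s)" for s :: real
  define b' where "b' s = 2 * max 0 (s - (1 - \<tau>))" for s :: real
  have a: "(a has_real_derivative a' s) (at s)" for s
    unfolding a_def[abs_def] a'_def
    by (rule DERIV_cong[OF DERIV_chain2[OF has_real_derivative_pos_part_sq, where Db = "-1"]])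
       (auto intro!: derivative_eq_intros)
  have b: "(b has_real_derivative b' s) (at s)" for s
    unfolding b_def[abs_def] b'_def
    by (rule DERIV_cong[OF DERIV_chain2[OF has_real_derivative_pos_part_sq, where Db = 1]])
       (auto intro!: derivative_eq_intros)
  have ab: "a s \<ge> 0" "b s \<ge> 0" for s by (auto simp: a_def b_def)
  have pos: "a s + b s > 0" for s
  proof (cases "s < 1")
    case True
    then have "a s > 0" by (simp add: a_def)
    then show ?thesis using ab(2)[of s] by linarith
  next
    case False
    then have "b s > 0" using assms by (simp add: b_def)
    then show ?thesis using ab(1)[of s] by linarith
  qed
  define p where "p s = a s / (a s + b s)" for s
  define p' where "p' s = (a' s * b s - a s * b' s) / (a s + b s)\<^sup>2" for s
  show ?thesis
  proof (rule that[of p p'])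
    show "(p has_real_derivative p' s) (at s)" for s
      unfolding p_def[abs_def] p'_def using pos[of s]
      by (intro DERIV_cong[OF DERIV_divide[OF a DERIV_add[OF a b]]])
         (auto simp: power2_eq_square algebra_simps)
    show "continuous_on UNIV p'"
      unfolding p'_def[abs_def] a_def b_def a'_def b'_def
      by (intro continuous_intros ballI) (use pos in \<open>auto simp: a_def b_def less_le\<close>)
    show "p s \<ge> 0" for s using ab[of s] by (simp add: p_def)
    show "p s = 0" if "s \<ge> 1" for s using that by (simp add: p_def a_def)
    show "p 0 = 1" using assms by (simp add: p_def a_def b_def)
    show "p' s \<le> 0" for s
    proof -
      have "a' s * b s \<le> 0" "a s * b' s \<ge> 0"
        using ab[of s] by (auto simp: a'_def b'_def intro: mult_nonpos_nonneg)
      then have "a' s * b s - a s * b' s \<le> 0" by linarith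
      then show ?thesis unfolding p'_def by (intro divide_nonpos_nonneg) auto
    qed
    show "p' s = 0" if "s < 1 - \<tau> \<or> s > 1" for s
      using that assms by (auto simp: p'_def a_def b_def a'_def b'_def)
  qed
qed

text \<open>The radial function that steps from 1 to 0 in the annulus \<open>1 - \<tau> \<le> x \<bullet> x \<le> 1\<close>. It is nonnegative and
  supported in the disc, its gradient is a nonnegative multiple of the calibration, and the latter has
  length at least \<open>1 - \<tau>\<close> in the annulus.\<close>

lemma calibration_near_maximizer:
  fixes \<tau> :: real
  assumes \<tau>: "0 < \<tau>" "\<tau> < 1"
  obtains f where "sobolev_fun f" "sobolev_norm f > 0"
    "(1 - \<tau>) * sobolev_norm f \<le> (LINT x|lebesgue. f x * calibration_kernel x)"
proof -
  obtain p p' :: "real \<Rightarrow> real" where p: "\<And>s. (p has_real_derivative p' s) (at s)" "continuous_on UNIV p'"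
    "\<And>s. p s \<ge> 0" "\<And>s. s \<ge> 1 \<Longrightarrow> p s = 0" "p 0 = 1" "\<And>s. p' s \<le> 0"
    "\<And>s. s < 1 - \<tau> \<or> s > 1 \<Longrightarrow> p' s = 0"
    using radial_step[OF \<tau>] by blast
  define f where "f x = p (x \<bullet> x)" for x :: "real^2"
  define g where "g x = (2 * p' (x \<bullet> x)) *\<^sub>R x" for x :: "real^2"
  have fg: "C1_gradient f g"
    unfolding f_def[abs_def] g_def[abs_def]
    using C1_gradient_sum_squares[of p p'] p(1) continuous_on_subset[OF p(2)] by auto
  have out: "f x = 0" if "x \<notin> cball 0 1" for x
  proof -
    have "1 \<le> norm x" using that by simp
    then have "1 \<le> (norm x)\<^sup>2" using one_le_power by blast
    then show ?thesis using p(4) by (simp add: f_def power2_norm_eq_inner)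
  qed
  have bnd: "bounded {x. f x \<noteq> 0}"
    by (rule bounded_subset[OF bounded_cball[of 0 1]]) (use out in blast)
  note f = C1_gradient_is_weak_gradient[OF fg bnd]
  have sob: "sobolev_fun f" using f by (auto simp: sobolev_fun_def)
  note k = calibration_deficit[OF f]
  have gi: "integrable lebesgue g" by (rule is_weak_gradient_integrable[OF f(2)])
  have "\<bar>f x\<bar> - indicator (cball 0 1) x * f x = 0" for x
    using out[of x] p(3)[of "x \<bullet> x"] by (cases "x \<in> cball 0 1") (simp_all add: f_def)
  then have "(LINT x|lebesgue. \<bar>f x\<bar> - indicator (cball 0 1) x * f x) = 0" by simp
  moreover have "(LINT x|lebesgue. norm (g x) - g x \<bullet> calibration x) \<le> (LINT x|lebesgue. \<tau> * norm (g x))"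
  proof (rule integral_mono[OF k(2)])
    show "integrable lebesgue (\<lambda>x. \<tau> * norm (g x))" using gi by simp
    fix x :: "real^2"
    show "norm (g x) - g x \<bullet> calibration x \<le> \<tau> * norm (g x)"
    proof (cases "1 - \<tau> \<le> x \<bullet> x \<and> x \<bullet> x \<le> 1")
      case True
      define r where "r = norm x"
      have r: "x \<bullet> x = r\<^sup>2" "r \<ge> 0" by (auto simp: r_def dot_square_norm)
      have "r \<le> 1" using True r by (simp add: abs_square_le_1)
      then have "r\<^sup>2 \<le> r" using r(2) by (simp add: power2_eq_square mult_left_le)
      then have "1 - \<tau> \<le> r" using True r by linarith
      have "(1 - \<tau>) * r \<le> r * r" using \<open>1 - \<tau> \<le> r\<close> r(2) by (rule mult_right_mono)
      also have "\<dots> \<le> profile (x \<bullet> x) * (r * r)"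
        using profile_ge_1[of "x \<bullet> x"] True r(2) mult_right_mono[of 1 "profile (x \<bullet> x)" "r * r"] by simp
      finally have "- (2 * p' (x \<bullet> x)) * ((1 - \<tau>) * r) \<le> - (2 * p' (x \<bullet> x)) * (profile (x \<bullet> x) * (r * r))"
        by (rule mult_left_mono) (use p(6)[of "x \<bullet> x"] in simp)
      moreover have "norm (g x) = - (2 * p' (x \<bullet> x)) * r"
        using p(6)[of "x \<bullet> x"] by (simp add: g_def r_def)
      moreover have "g x \<bullet> calibration x = - (2 * p' (x \<bullet> x)) * (profile (x \<bullet> x) * (r * r))"
        by (simp add: g_def calibration_def r(1) power2_eq_square)
      ultimately show ?thesis by (simp add: algebra_simps)
    next
      case False
      then have "p' (x \<bullet> x) = 0" by (intro p(7)) auto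
      then show ?thesis by (simp add: g_def)
    qed
  qed
  moreover have "(LINT x|lebesgue. \<tau> * norm (g x)) \<le> \<tau> * sobolev_norm f"
    using \<tau> by (simp add: sobolev_norm_eq[OF f(2)])
  ultimately have "sobolev_norm f - (LINT x|lebesgue. f x * calibration_kernel x) \<le> \<tau> * sobolev_norm f"
    using k(3) by simp
  then have ge: "(1 - \<tau>) * sobolev_norm f \<le> (LINT x|lebesgue. f x * calibration_kernel x)"
    by (simp add: algebra_simps)
  have "sobolev_norm f \<noteq> 0"
  proof
    assume "sobolev_norm f = 0"
    then have "AE x in lebesgue. x \<notin> {x. f x \<noteq> 0}" using sobolev_norm_eq_0[OF sob] by simp
    moreover have op: "open {x. f x \<noteq> 0}"
      using C1_gradient_continuous(1)[OF fg] open_Collect_neq[of f "\<lambda>x. 0"] by auto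
    ultimately have "negligible {x. f x \<noteq> 0}"
      unfolding negligible_iff_null_sets by (subst AE_iff_null_sets) auto
    moreover have "f 0 \<noteq> 0" using p(5) by (simp add: f_def)
    ultimately show False using open_not_negligible[OF op] by blast
  qed
  then show ?thesis using that[OF sob _ ge] sobolev_norm_nonneg[of f] by linarith
qed

lift_definition calibration_integral :: "W11 \<Rightarrow> real" is "\<lambda>f. LINT x|lebesgue. f x * calibration_kernel x"
proof -
  fix f g assume "sobolev_eq f g"
  then have "AE x in lebesgue. f x = g x" "f \<in> borel_measurable lebesgue" "g \<in> borel_measurable lebesgue"
    by (auto simp: sobolev_eq_def sobolev_fun_def)
  then show "(LINT x|lebesgue. f x * calibration_kernel x) = (LINT x|lebesgue. g x * calibration_kernel x)"
    by (intro integral_cong_AE borel_measurable_times calibration_kernel_measurable) (auto elim: eventually_mono)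
qed

lemma calibration_integral_abs:
  "sobolev_fun f \<Longrightarrow> calibration_integral (abs_W11 f) = (LINT x|lebesgue. f x * calibration_kernel x)"
  by (simp add: calibration_integral.abs_eq sobolev_eq_refl)

lemma calibration_kernel_integral_le_norm:
  assumes "sobolev_fun f"
  shows "(LINT x|lebesgue. f x * calibration_kernel x) \<le> sobolev_norm f"
proof -
  have "integrable lebesgue f" using assms by (simp add: sobolev_fun_def)
  note k = calibration_deficit[OF this weak_gradient[OF assms]]
  have "(LINT x|lebesgue. \<bar>f x\<bar> - indicator (cball 0 1) x * f x) \<ge> 0"
    "(LINT x|lebesgue. norm (weak_gradient f x) - weak_gradient f x \<bullet> calibration x) \<ge> 0"
    using k(4,5) by (auto intro: integral_nonneg)
  then show ?thesis using k(3) by linarith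
qed

lemma calibration_integral_le_norm: "calibration_integral X \<le> norm X"
  by (cases X rule: abs_W11_cases)
     (simp add: calibration_integral_abs norm_abs_W11 calibration_kernel_integral_le_norm)

lemma bounded_linear_calibration_integral: "bounded_linear calibration_integral"
proof (rule bounded_linear_intro[where K = 1])
  have int: "integrable lebesgue (\<lambda>x. f x * calibration_kernel x)" if "sobolev_fun f" for f
    using that by (intro integrable_mult_bounded[OF _ calibration_kernel_measurable calibration_kernel_bound])
      (simp add: sobolev_fun_def)
  show "calibration_integral (X + Y) = calibration_integral X + calibration_integral Y" for X Y
    by (cases X rule: abs_W11_cases, cases Y rule: abs_W11_cases)
       (simp add: plus_W11.abs_eq sobolev_eq_refl calibration_integral_abs sobolev_fun_add distrib_right int)
  show scale: "calibration_integral (c *\<^sub>R X) = c *\<^sub>R calibration_integral X" for c X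
    by (cases X rule: abs_W11_cases)
       (simp add: scaleR_W11.abs_eq sobolev_eq_refl calibration_integral_abs sobolev_fun_scale mult.assoc)
  show "norm (calibration_integral X) \<le> norm X * 1" for X
    using calibration_integral_le_norm[of X] calibration_integral_le_norm[of "(-1) *\<^sub>R X"] by (simp only: scale norm_scaleR) (simp add: abs_le_iff)
qed

definition calibration_functional :: "W11 \<Rightarrow>\<^sub>L real" where
  "calibration_functional = Blinfun calibration_integral"

lemma calibration_functional_apply [simp]:
  "blinfun_apply calibration_functional = calibration_integral"
  by (simp add: calibration_functional_def bounded_linear_Blinfun_apply bounded_linear_calibration_integral)

lemma norm_calibration_functional: "norm calibration_functional = 1"
proof (rule antisym)
  interpret bounded_linear calibration_integral by (rule bounded_linear_calibration_integral)
  show "norm calibration_functional \<le> 1"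
  proof (rule norm_blinfun_bound)
    show "norm (blinfun_apply calibration_functional X) \<le> 1 * norm X" for X
      using calibration_integral_le_norm[of X] calibration_integral_le_norm[of "- X"] by (simp add: neg abs_le_iff)
  qed simp
  show "1 \<le> norm calibration_functional"
  proof (rule ccontr)
    assume "\<not> 1 \<le> norm calibration_functional"
    then have lt: "norm calibration_functional < 1" by simp
    define \<tau> where "\<tau> = (1 - norm calibration_functional) / 2"
    have \<tau>: "0 < \<tau>" using lt by (simp add: \<tau>_def)
    have \<tau>1: "\<tau> < 1" by (simp add: \<tau>_def less_le_trans[OF _ norm_ge_zero])
    obtain f where f: "sobolev_fun f" "sobolev_norm f > 0"
      "(1 - \<tau>) * sobolev_norm f \<le> (LINT x|lebesgue. f x * calibration_kernel x)"
      using calibration_near_maximizer[OF \<tau> \<tau>1] by blast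
    have "\<bar>LINT x|lebesgue. f x * calibration_kernel x\<bar> \<le> norm calibration_functional * sobolev_norm f"
      using norm_blinfun[of calibration_functional "abs_W11 f"]
      by (simp add: f(1) calibration_integral_abs norm_abs_W11)
    then have "(1 - \<tau>) * sobolev_norm f \<le> norm calibration_functional * sobolev_norm f"
      using f(3) by linarith
    then have "1 - \<tau> \<le> norm calibration_functional" using f(2) by (rule mult_right_le_imp_le)
    then show False using lt by (simp add: \<tau>_def field_simps)
  qed
qed

section \<open>Mass near the origin\<close>

text \<open>In terms of \<open>s = x \<bullet> x\<close> this is minus the divergence of the field \<open>\<theta> s *\<^sub>R calibration x\<close> with
  \<open>\<theta> s = 1 / (1 + 4096 * s)\<close>. The damping factor \<open>\<theta>\<close> decays fast enough for the flux
  of the field to decrease from \<open>s = 1/32\<close> onwards, which makes the kernel negative there; positive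
  values occur only where the bump is at least \<open>1/16\<close>. The number 4096 serves this purpose: it gives
  \<open>8192 * s\<^sup>2 \<ge> 8\<close> for \<open>s \<ge> 1/32\<close>.\<close>

definition transport_kernel :: "real \<Rightarrow> real" where
  "transport_kernel s = max 0 (5 - s) * (5 - 3 * s - 8192 * s\<^sup>2) / (8 * (1 + 4096 * s)\<^sup>2)"

text \<open>Since \<open>0 \<le> \<theta> \<le> 1\<close>, the integrand \<open>\<theta> * (\<nabla>f \<bullet> calibration)\<close> is at least
  \<open>\<nabla>f \<bullet> calibration - norm (\<nabla>f)\<close>.\<close>

lemma transport_kernel_integral_ge:
  assumes f: "integrable lebesgue f" "is_weak_gradient f g"
  shows "- (LINT x|lebesgue. norm (g x) - g x \<bullet> calibration x)
    \<le> (LINT x|lebesgue. f x * transport_kernel (x \<bullet> x))"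
proof -
  note k = calibration_deficit[OF f]
  define \<theta> where "\<theta> s = 1 / (1 + 4096 * s)" for s :: real
  define P' where "P' s = (- max 0 (5 - s) / 8) * \<theta> s + profile s * (- 4096 / (1 + 4096 * s)\<^sup>2)" for s :: real
  have P: "((\<lambda>s. profile s * \<theta> s) has_real_derivative P' s) (at s)" if "s \<ge> 0" for s
  proof -
    have "(\<theta> has_real_derivative - 4096 / (1 + 4096 * s)\<^sup>2) (at s)"
      unfolding \<theta>_def[abs_def] using that
      by (auto intro!: derivative_eq_intros simp: power2_eq_square)
    from DERIV_mult[OF profile_derivative this] show ?thesis
      by (simp add: P'_def algebra_simps)
  qed
  have A: "(LINT x|lebesgue. f x * (2 * (profile (x \<bullet> x) * \<theta> (x \<bullet> x)) + 2 * (x \<bullet> x) * P' (x \<bullet> x)))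
    = - (LINT x|lebesgue. profile (x \<bullet> x) * \<theta> (x \<bullet> x) * (g x \<bullet> x))"
  proof (rule radial_integral_by_parts[OF f P, where R = 5])
    show "continuous_on {0..} P'"
      unfolding P'_def[abs_def] \<theta>_def profile_def
      by (intro continuous_intros) (auto simp: add_nonneg_eq_0_iff add_pos_nonneg less_imp_neq[symmetric])
  qed (auto simp: profile_def)
  have B: "2 * (profile s * \<theta> s) + 2 * s * P' s = transport_kernel s" if "s \<ge> 0" for s
  proof -
    define D where "D = 1 + 4096 * s"
    have D: "D > 0" using that by (simp add: D_def)
    have "2 * (profile s * \<theta> s) + 2 * s * P' s
      = max 0 (5 - s) * (max 0 (5 - s) * D - 2 * s * D - 4096 * s * max 0 (5 - s)) / (8 * D\<^sup>2)"
      unfolding P'_def \<theta>_def profile_def D_def[symmetric] using D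
      by (simp add: power2_eq_square field_simps)
    also have "max 0 (5 - s) * (max 0 (5 - s) * D - 2 * s * D - 4096 * s * max 0 (5 - s))
      = max 0 (5 - s) * (5 - 3 * s - 8192 * s\<^sup>2)"
      by (cases "s \<le> 5") (auto simp: D_def power2_eq_square algebra_simps)
    finally show ?thesis by (simp add: transport_kernel_def D_def)
  qed
  have "(LINT x|lebesgue. f x * transport_kernel (x \<bullet> x))
      = - (LINT x|lebesgue. profile (x \<bullet> x) * \<theta> (x \<bullet> x) * (g x \<bullet> x))"
    unfolding A[symmetric] B[OF inner_ge_zero] ..
  also have "\<dots> = (LINT x|lebesgue. \<theta> (x \<bullet> x) * (g x \<bullet> calibration x))"
    by (simp add: calibration_def mult_ac flip: integral_minus)
  finally have eq: "(LINT x|lebesgue. f x * transport_kernel (x \<bullet> x))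
      = (LINT x|lebesgue. \<theta> (x \<bullet> x) * (g x \<bullet> calibration x))" .
  have \<theta>: "0 \<le> \<theta> (x \<bullet> x)" "\<theta> (x \<bullet> x) \<le> 1" for x :: "real^2"
    by (simp_all add: \<theta>_def divide_le_eq add_pos_nonneg)
  have "(LINT x|lebesgue. - (norm (g x) - g x \<bullet> calibration x))
      \<le> (LINT x|lebesgue. \<theta> (x \<bullet> x) * (g x \<bullet> calibration x))"
  proof (rule integral_mono)
    show "integrable lebesgue (\<lambda>x. - (norm (g x) - g x \<bullet> calibration x))" using k(2) by (intro integrable_minus)
    have "continuous_on UNIV (\<lambda>x::real^2. \<theta> (x \<bullet> x))"
      unfolding \<theta>_def by (intro continuous_intros) (auto simp: add_nonneg_eq_0_iff)
    then have "(\<lambda>x::real^2. \<theta> (x \<bullet> x)) \<in> borel_measurable lebesgue" by (rule continuous_lebesgue_measurable)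
    then have "integrable lebesgue (\<lambda>x. g x \<bullet> calibration x * \<theta> (x \<bullet> x))"
      by (rule integrable_mult_bounded[OF integral_calibration_kernel(2)[OF f], where C = 1]) (use \<theta> in auto)
    then show "integrable lebesgue (\<lambda>x. \<theta> (x \<bullet> x) * (g x \<bullet> calibration x))" by (simp add: mult.commute)
    fix x
    have "\<theta> (x \<bullet> x) * (norm (g x) - g x \<bullet> calibration x) \<le> norm (g x) - g x \<bullet> calibration x"
      using mult_right_mono[OF \<theta>(2) k(5)] by simp
    moreover have "\<theta> (x \<bullet> x) * norm (g x) \<ge> 0" using \<theta> by simp
    ultimately show "- (norm (g x) - g x \<bullet> calibration x) \<le> \<theta> (x \<bullet> x) * (g x \<bullet> calibration x)"
      by (simp add: algebra_simps)
  qed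
  then show ?thesis by (simp add: eq flip: integral_minus)
qed

lemma transport_kernel_bound:
  assumes "s \<ge> 0"
  shows "\<bar>transport_kernel s\<bar> \<le> 4"
proof -
  have "\<bar>5 - 3 * s - 8192 * s\<^sup>2\<bar> \<le> 5 + 3 * s + 8192 * s\<^sup>2" using assms by (auto simp: abs_le_iff)
  also have "\<dots> \<le> 5 * (1 + 4096 * s)\<^sup>2" using assms by (simp add: power2_eq_square algebra_simps)
  finally have "\<bar>max 0 (5 - s)\<bar> * \<bar>5 - 3 * s - 8192 * s\<^sup>2\<bar> \<le> 5 * (5 * (1 + 4096 * s)\<^sup>2)"
    using assms by (intro mult_mono) auto
  also have "\<dots> \<le> 4 * (8 * (1 + 4096 * s)\<^sup>2)" by simp
  finally show ?thesis
    unfolding transport_kernel_def abs_mult abs_divide using assms by (simp add: divide_le_eq add_pos_nonneg)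
qed

lemma transport_kernel_shell:
  assumes "1/32 \<le> s" "s \<le> 1"
  shows "transport_kernel s \<le> - (1 / 4097\<^sup>2)"
proof -
  have "(1/32)\<^sup>2 \<le> s\<^sup>2" using assms by (intro power_mono) auto
  then have br: "5 - 3 * s - 8192 * s\<^sup>2 \<le> -3" using assms by (simp add: power2_eq_square)
  have "8 \<le> (5 - s) * (- (5 - 3 * s - 8192 * s\<^sup>2))"
    using assms br mult_mono[of 4 "5 - s" 2 "- (5 - 3 * s - 8192 * s\<^sup>2)"] by simp
  moreover have "max 0 (5 - s) = 5 - s" using assms by simp
  ultimately have 1: "max 0 (5 - s) * (5 - 3 * s - 8192 * s\<^sup>2) \<le> - 8"
    unfolding mult_minus_right by linarith
  have "(1 + 4096 * s)\<^sup>2 \<le> 4097\<^sup>2" using assms by (intro power_mono) auto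
  then have D: "0 < (1 + 4096 * s)\<^sup>2" "(1 + 4096 * s)\<^sup>2 \<le> 4097\<^sup>2" using assms by auto
  have "transport_kernel s \<le> -8 / (8 * (1 + 4096 * s)\<^sup>2)"
    unfolding transport_kernel_def by (rule divide_right_mono[OF 1]) simp
  also have "\<dots> \<le> - (1 / 4097\<^sup>2)" using D by (simp add: frac_le)
  finally show ?thesis .
qed

lemma bump_ge:
  assumes "x \<bullet> x \<le> 1/32"
  shows "bump x \<ge> 1/16"
proof -
  have s: "x \<bullet> x = (x $ 1)\<^sup>2 + (x $ 2)\<^sup>2" by (simp add: inner_vec_def sum_2 power2_eq_square)
  have "1/4 * (1/4) \<le> cutoff (x $ 1) * cutoff (x $ 2)"
    by (intro mult_mono cutoff_ge cutoff_nonneg)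
       (use assms s zero_le_power2[of "x $ 1"] zero_le_power2[of "x $ 2"] in \<open>linarith\<close>)+
  then show ?thesis by (simp add: bump_def)
qed

lemma transport_kernel_le_bump:
  assumes "norm x \<le> 1" and c: "c = 1 / 4097\<^sup>2"
  shows "transport_kernel (x \<bullet> x) \<le> 16 * (4 + c) * bump x - c"
proof (cases "x \<bullet> x \<le> 1/32")
  case True
  have "c > 0" by (simp add: c)
  then have "16 * (4 + c) * (1/16) \<le> 16 * (4 + c) * bump x"
    by (intro mult_left_mono bump_ge True) auto
  then show ?thesis using transport_kernel_bound[of "x \<bullet> x"] by (simp add: abs_le_iff)
next
  case False
  have "x \<bullet> x \<le> 1" using assms(1) by (simp add: dot_square_norm power_le_one)
  then have "transport_kernel (x \<bullet> x) \<le> - c"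
    unfolding c by (intro transport_kernel_shell) (use False in auto)
  moreover have "16 * (4 + c) * bump x \<ge> 0" using c bump_nonneg by simp
  ultimately show ?thesis by linarith
qed

lemma bump_outside: "norm x > 1 \<Longrightarrow> bump x = 0"
proof -
  assume "norm x > 1"
  have "norm x \<le> \<bar>x $ 1\<bar> + \<bar>x $ 2\<bar>" using norm_le_l1_cart[of x] by (simp add: sum_2)
  then have "\<bar>x $ 1\<bar> \<ge> 1/4 \<or> \<bar>x $ 2\<bar> \<ge> 1/4" using \<open>norm x > 1\<close> by linarith
  then show ?thesis using bump_eq_0 by blast
qed

lemma bump_integrable:
  "integrable lebesgue f \<Longrightarrow> integrable lebesgue (\<lambda>x. f x * bump x)"
  by (rule separable_bump_bound_integrable) (auto simp: separable_bump bump_nonneg)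

text \<open>By \<open>transport_kernel_integral_ge\<close> the integral of \<open>f\<close> against the transport kernel is at least
  \<open>-\<epsilon>\<close>. In the disc the kernel lies below a multiple of the bump minus \<open>c\<close>. So a fixed fraction of the
  total mass of \<open>f\<close> must be seen by the bump, up to \<open>O(\<epsilon>)\<close>. The total mass is bounded
  below because the functional is integration against a kernel bounded by 5.\<close>

lemma bump_mass_near_maximizer:
  assumes f: "integrable lebesgue f" "is_weak_gradient f g"
    and near: "sobolev_norm f \<le> 1" "(LINT x|lebesgue. f x * calibration_kernel x) > 1 - \<epsilon>"
    and c: "c = 1 / 4097\<^sup>2" and \<epsilon>: "\<epsilon> = c / 10000"
  shows "(LINT x|lebesgue. f x * bump x) \<ge> c / 600"
proof -
  have c01: "0 < c" "c \<le> 1" by (auto simp: c)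
  define M where "M = 16 * (4 + c)"
  define e where "e x = \<bar>f x\<bar> - indicator (cball 0 1) x * f x" for x
  note k = calibration_deficit[OF f, folded e_def]
  note def = deficits_of_near_maximizer[OF f near, folded e_def]
  \<comment> \<open>\<open>f\<close> differs from \<open>\<bar>f\<bar>\<close> on the disc, and from 0 outside it, only by \<open>e\<close>, whose integral is at most \<open>\<epsilon>\<close>\<close>
  have point: "f x * transport_kernel (x \<bullet> x) \<le> M * (f x * bump x) - c * \<bar>f x\<bar> + (M + c + 4) * e x" for x
  proof (cases "x \<in> cball 0 1")
    case True
    then have fe: "f x = \<bar>f x\<bar> - e x" and nx: "norm x \<le> 1" by (auto simp: e_def)
    have t: "\<bar>transport_kernel (x \<bullet> x)\<bar> \<le> 4" by (rule transport_kernel_bound) simp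
    have "\<bar>f x\<bar> * transport_kernel (x \<bullet> x) \<le> \<bar>f x\<bar> * (M * bump x - c)"
      unfolding M_def by (intro mult_left_mono transport_kernel_le_bump nx c) simp
    moreover have "e x * (- transport_kernel (x \<bullet> x)) \<le> e x * 4"
      using t k(4)[of x] by (intro mult_left_mono) (auto simp: abs_le_iff)
    moreover have "f x * transport_kernel (x \<bullet> x)
        = \<bar>f x\<bar> * transport_kernel (x \<bullet> x) + e x * (- transport_kernel (x \<bullet> x))"
      by (subst fe) (simp add: algebra_simps)
    moreover have "M * (f x * bump x) = M * (\<bar>f x\<bar> * bump x) - M * (e x * bump x)"
      by (subst fe) (simp add: algebra_simps)
    moreover have "M * (e x * bump x) \<le> M * e x"
      using k(4)[of x] bump_le_1[of x] c01 by (intro mult_left_mono mult_left_le) (auto simp: M_def)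
    moreover have "c * e x \<ge> 0" using k(4)[of x] c01 by simp
    ultimately show ?thesis by (simp add: algebra_simps)
  next
    case False
    then have e: "e x = \<bar>f x\<bar>" by (simp add: e_def)
    have "f x * transport_kernel (x \<bullet> x) \<le> \<bar>f x\<bar> * \<bar>transport_kernel (x \<bullet> x)\<bar>"
      by (metis abs_ge_self abs_mult)
    also have "\<dots> \<le> \<bar>f x\<bar> * 4" by (intro mult_left_mono transport_kernel_bound) auto
    finally have "f x * transport_kernel (x \<bullet> x) \<le> 4 * \<bar>f x\<bar>" by simp
    moreover have "M * \<bar>f x\<bar> \<ge> 0" using c01 by (simp add: M_def)
    moreover have "bump x = 0" using False by (intro bump_outside) simp
    ultimately show ?thesis by (simp add: e algebra_simps)
  qed
  have tk: "(\<lambda>x::real^2. transport_kernel (x \<bullet> x)) \<in> borel_measurable lebesgue"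
    unfolding transport_kernel_def
    by (intro continuous_lebesgue_measurable continuous_intros) (auto simp: add_nonneg_eq_0_iff)
  have "(LINT x|lebesgue. f x * transport_kernel (x \<bullet> x))
      \<le> (LINT x|lebesgue. M * (f x * bump x) - c * \<bar>f x\<bar> + (M + c + 4) * e x)"
    using point f(1) k(1) bump_integrable[OF f(1)]
    by (intro integral_mono integrable_mult_bounded[OF f(1) tk, where C = 4])
       (auto intro!: transport_kernel_bound)
  also have "\<dots> = M * (LINT x|lebesgue. f x * bump x) - c * (LINT x|lebesgue. \<bar>f x\<bar>)
      + (M + c + 4) * (LINT x|lebesgue. e x)"
    using f(1) k(1) bump_integrable[OF f(1)] by simp
  finally have 1: "- \<epsilon> \<le> M * (LINT x|lebesgue. f x * bump x) - c * (LINT x|lebesgue. \<bar>f x\<bar>)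
      + (M + c + 4) * (LINT x|lebesgue. e x)"
    using transport_kernel_integral_ge[OF f] def(2) by linarith
  have "(LINT x|lebesgue. f x * calibration_kernel x) \<le> (LINT x|lebesgue. 5 * \<bar>f x\<bar>)"
  proof (rule integral_mono)
    show "integrable lebesgue (\<lambda>x. f x * calibration_kernel x)"
      by (rule integrable_mult_bounded[OF f(1) calibration_kernel_measurable calibration_kernel_bound])
    show "f x * calibration_kernel x \<le> 5 * \<bar>f x\<bar>" for x
      using order_trans[OF abs_ge_self, of "f x * calibration_kernel x"] mult_left_mono[OF calibration_kernel_bound[of x], of "\<bar>f x\<bar>"]
      by (simp add: abs_mult mult.commute)
  qed (use f(1) in simp)
  then have "1 - \<epsilon> < 5 * (LINT x|lebesgue. \<bar>f x\<bar>)" using near(2) by simp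
  then have "1/6 \<le> (LINT x|lebesgue. \<bar>f x\<bar>)" using \<epsilon> c01 by linarith
  then have 2: "c * (1/6) \<le> c * (LINT x|lebesgue. \<bar>f x\<bar>)" using c01 by (intro mult_left_mono) auto
  \<comment> \<open>\<open>M \<le> 80\<close> and \<open>c \<le> 1\<close>, so that the errors total at most \<open>86 * \<epsilon>\<close>\<close>
  have "(M + c + 4) * (LINT x|lebesgue. e x) \<le> 85 * \<epsilon>"
    using def(1) c01 k(4) by (intro mult_mono) (auto simp: M_def)
  with 1 2 have 3: "c * (1/6) - 86 * \<epsilon> \<le> M * (LINT x|lebesgue. f x * bump x)" by linarith
  moreover have "M \<le> 80" "M > 0" using c01 by (auto simp: M_def)
  then have "M * (c / 600) \<le> 80 * (c / 600)" using c01 by (intro mult_right_mono) auto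
  then have "M * (c / 600) \<le> c * (1/6) - 86 * \<epsilon>" using \<epsilon> c01 by linarith
  ultimately have "M * (c / 600) \<le> M * (LINT x|lebesgue. f x * bump x)" by linarith
  then show ?thesis using \<open>M > 0\<close> by simp
qed

section \<open>The slice\<close>

text \<open>Split the \<open>L\<^sup>1\<close> norm of \<open>f - g\<close> by the partition of unity \<open>bump + (1 - bump)\<close>. Against \<open>1 - bump\<close> the triangle
  inequality suffices. Against the bump the Poincare inequality leaves only \<open>\<bar>a - b\<bar> + 16 * \<epsilon>\<close>,
  where \<open>a\<close> and \<open>b\<close> are the bump masses, instead of \<open>a + b\<close>. The gain \<open>2 * min a b\<close> exceeds
  \<open>17 * \<epsilon>\<close>, and the gradients contribute at most the sum of their norms.\<close>

lemma near_maximizers_close: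
  assumes f: "sobolev_fun f" "sobolev_norm f \<le> 1" "(LINT x|lebesgue. f x * calibration_kernel x) > 1 - \<epsilon>"
    and g: "sobolev_fun g" "sobolev_norm g \<le> 1" "(LINT x|lebesgue. g x * calibration_kernel x) > 1 - \<epsilon>"
    and \<epsilon>: "\<epsilon> = 1 / (10000 * 4097\<^sup>2)"
  shows "sobolev_norm (\<lambda>x. f x - g x) \<le> 2 - \<epsilon>"
proof -
  define c :: real where "c = 1 / 4097\<^sup>2"
  have \<epsilon>c: "\<epsilon> = c / 10000" by (simp add: \<epsilon> c_def)
  have c0: "c > 0" by (simp add: c_def)
  define F where "F = weak_gradient f"
  define G where "G = weak_gradient g"
  have wf: "integrable lebesgue f" "is_weak_gradient f F" and wg: "integrable lebesgue g" "is_weak_gradient g G"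
    using f(1) g(1) weak_gradient by (auto simp: F_def G_def sobolev_fun_def)
  have iF: "integrable lebesgue F" and iG: "integrable lebesgue G"
    using wf wg is_weak_gradient_integrable by auto
  have wd: "integrable lebesgue (\<lambda>x. f x - g x)" "is_weak_gradient (\<lambda>x. f x - g x) (\<lambda>x. F x - G x)"
    using wf wg is_weak_gradient_add[OF wf wg(1)[THEN integrable_mult_right[of "-1"]] is_weak_gradient_scale[OF wg(2), of "-1"]]
    by auto
  define a where "a = (LINT x|lebesgue. f x * bump x)"
  define b where "b = (LINT x|lebesgue. g x * bump x)"
  have a: "a \<ge> c / 600" and b: "b \<ge> c / 600"
    unfolding a_def b_def
    using bump_mass_near_maximizer[OF wf f(2,3) c_def \<epsilon>c] bump_mass_near_maximizer[OF wg g(2,3) c_def \<epsilon>c] by auto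
  note ib = bump_integrable[OF wf(1)] bump_integrable[OF wg(1)]
    bump_integrable[OF integrable_abs[OF wf(1)]] bump_integrable[OF integrable_abs[OF wg(1)]]
    bump_integrable[OF integrable_abs[OF wd(1)]]
  have sq: "integrable lebesgue (\<lambda>x. indicator square x * norm (F x))"
    "integrable lebesgue (\<lambda>x. indicator square x * norm (G x))"
    using integrable_mult_indicator[OF square_lebesgue integrable_norm[OF iF]]
      integrable_mult_indicator[OF square_lebesgue integrable_norm[OF iG]] by simp_all
  have "(LINT x|lebesgue. indicator square x * norm (F x - G x))
      \<le> (LINT x|lebesgue. indicator square x * norm (F x) + indicator square x * norm (G x))"
  proof (rule integral_mono')
    show "integrable lebesgue (\<lambda>x. indicator square x * norm (F x) + indicator square x * norm (G x))"
      using sq by (rule Bochner_Integration.integrable_add)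
    show "indicator square x * norm (F x - G x) \<le> indicator square x * norm (F x) + indicator square x * norm (G x)" for x
      by (cases "x \<in> square") (auto simp: norm_triangle_ineq4)
  qed simp
  also have "\<dots> = (LINT x|lebesgue. indicator square x * norm (F x)) + (LINT x|lebesgue. indicator square x * norm (G x))"
    using sq by simp
  also have "\<dots> \<le> 8 * \<epsilon>"
    using gradient_square_le_deficit[OF wf] gradient_square_le_deficit[OF wg]
      deficits_of_near_maximizer(2)[OF wf f(2,3)] deficits_of_near_maximizer(2)[OF wg g(2,3)] by linarith
  finally have grad: "(LINT x|lebesgue. indicator square x * norm (F x - G x)) \<le> 8 * \<epsilon>" .
  have "(LINT x|lebesgue. (f x - g x) * bump x) = a - b"
    using ib by (simp add: a_def b_def left_diff_distrib)
  then have in_bump: "(LINT x|lebesgue. \<bar>f x - g x\<bar> * bump x) \<le> \<bar>a - b\<bar> + 16 * \<epsilon>"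
    using weighted_poincare[OF wd] grad by linarith
  have "(LINT x|lebesgue. \<bar>f x - g x\<bar> - \<bar>f x - g x\<bar> * bump x)
      \<le> (LINT x|lebesgue. (\<bar>f x\<bar> - f x * bump x) + (\<bar>g x\<bar> - g x * bump x))"
  proof (rule integral_mono)
    fix x
    have "\<bar>f x - g x\<bar> * (1 - bump x) \<le> (\<bar>f x\<bar> + \<bar>g x\<bar>) * (1 - bump x)"
      using bump_le_1[of x] by (intro mult_right_mono) auto
    moreover have "f x * bump x \<le> \<bar>f x\<bar> * bump x" "g x * bump x \<le> \<bar>g x\<bar> * bump x"
      using bump_nonneg[of x] by (auto intro: mult_right_mono)
    ultimately show "\<bar>f x - g x\<bar> - \<bar>f x - g x\<bar> * bump x \<le> (\<bar>f x\<bar> - f x * bump x) + (\<bar>g x\<bar> - g x * bump x)"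
      by (simp add: algebra_simps)
  qed (use ib wf wg wd in auto)
  also have "\<dots> = (LINT x|lebesgue. \<bar>f x\<bar>) - a + ((LINT x|lebesgue. \<bar>g x\<bar>) - b)"
    using ib wf wg by (simp add: a_def b_def)
  finally have out_bump: "(LINT x|lebesgue. \<bar>f x - g x\<bar>) - (LINT x|lebesgue. \<bar>f x - g x\<bar> * bump x)
      \<le> (LINT x|lebesgue. \<bar>f x\<bar>) - a + ((LINT x|lebesgue. \<bar>g x\<bar>) - b)"
    using ib wd by simp
  have "(LINT x|lebesgue. norm (F x - G x)) \<le> (LINT x|lebesgue. norm (F x) + norm (G x))"
    using iF iG by (intro integral_mono) (auto simp: norm_triangle_ineq4)
  also have "\<dots> = (LINT x|lebesgue. norm (F x)) + (LINT x|lebesgue. norm (G x))" using iF iG by simp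
  finally have "sobolev_norm (\<lambda>x. f x - g x) \<le> sobolev_norm f + sobolev_norm g - a - b + \<bar>a - b\<bar> + 16 * \<epsilon>"
    using in_bump out_bump
    unfolding sobolev_norm_eq[OF wf(2)] sobolev_norm_eq[OF wg(2)] sobolev_norm_eq[OF wd(2)] by linarith
  then show ?thesis using f(2) g(2) a b c0 \<epsilon>c by linarith
qed

theorem theorem3p2:
  shows "\<not> slice_diameter_two_property TYPE(W11)"
proof
  define \<epsilon> :: real where "\<epsilon> = 1 / (10000 * 4097\<^sup>2)"
  have \<epsilon>: "0 < \<epsilon>" "\<epsilon> \<le> 1" by (auto simp: \<epsilon>_def)
  let ?S = "slice (cball 0 1) calibration_functional \<epsilon>"
  assume "slice_diameter_two_property TYPE(W11)"
  then have two: "diameter ?S = 2"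
    unfolding slice_diameter_two_property_def using \<epsilon> norm_calibration_functional by blast
  have "diameter ?S \<le> 2 - \<epsilon>"
  proof (rule diameter_le)
    show "?S \<noteq> {} \<or> 0 \<le> 2 - \<epsilon>" using \<epsilon> by simp
    fix X Y assume "X \<in> ?S" "Y \<in> ?S"
    moreover obtain f where f: "sobolev_fun f" "X = abs_W11 f" by (rule abs_W11_cases)
    moreover obtain g where g: "sobolev_fun g" "Y = abs_W11 g" by (rule abs_W11_cases)
    ultimately have "sobolev_norm (\<lambda>x. f x - g x) \<le> 2 - \<epsilon>"
      by (intro near_maximizers_close[OF f(1) _ _ g(1) _ _ \<epsilon>_def])
         (auto simp: slice_def calibration_integral_abs norm_abs_W11)
    moreover have "sobolev_fun (\<lambda>x. f x - g x)"
      using sobolev_fun_add[OF f(1) sobolev_fun_scale[OF g(1), of "-1"]] by simp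
    ultimately show "norm (X - Y) \<le> 2 - \<epsilon>"
      by (simp add: f g minus_abs_W11 norm_abs_W11)
  qed
  then show False using two \<epsilon> by simp
qed

end
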